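(* Let $(Y,\omega,I,\varphi)$ be a symplectic $\mathbb{C}^*$-manifold over a convex base. The specialised $\varphi$-filtration $\mathcal{F}^\varphi_{\mathbb{B},\lambda}:=\mathrm{ini}(\mathcal{F}^\varphi_\lambda)\subset H^*(Y;\mathbb{B})$ is a filtration of $H^*(Y;\mathbb{B})$ by ideals with respect to cup product, with $\mathrm{rank}_{\mathbb{B}}\,\mathcal{F}^\varphi_{\mathbb{B},\lambda}=\mathrm{rank}_{\mathbb{K}}\,\mathcal{F}^\varphi_\lambda$.
   Context: **Symplectic $\mathbb{C}^*$-manifolds over a convex base.** A symplectic $\mathbb{C}^*$-manifold $(Y,\omega,I,\varphi)$ is a connected symplectic manifold with an $\omega$-compatible almost complex structure $I$ and an $I$-pseudoholomorphic $\mathbb{C}^*$-action $\varphi$ whose $S^1$-part is Hamiltonian. The circle $S^1=\mathbb{R}/\mathbb{Z}$ has vector field $X_{S^1}=X_H$, where $H:Y\to\mathbb{R}$ is the moment map, $\omega(\cdot,X_H)=dH$. It is *over a convex base* if on the complement $Y^{\mathrm{out}}$ of the interior of a compact subdomain there is a proper $(I,I_B)$-pseudoholomorphic map $\Psi:Y^{\mathrm{out}}\to B^{\mathrm{out}}=\Sigma\times[R_0,\infty)$, where $(\Sigma,\alpha)$ is a closed contact manifold, $B^{\mathrm{out}}$ carries the symplectic form $d(R\alpha)$ and a compatible almost complex structure $I_B$ of contact type ($dR=R\alpha\circ I_B$) and is geometrically bounded at infinity, such that $\Psi_*X_{S^1}=X_{fR}$ for a Reeb-invariant function $f:\Sigma\to(0,\infty)$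 (for $f\equiv1$, $X_R$ is the Reeb field). $Y$ is non-compact. The fixed locus is then compact and $H$ is bounded below; $H$ is assumed proper. **Floer theory.** Let $\dim_{\mathbb{R}}Y=2n$. Standing assumption: $Y$ is *weakly monotone*, i.e. at least one of: (1) $c_1(Y)(A)=0$ for all $A\in\pi_2(Y)$; (2) $\omega(A)=0$ for all $A\in\pi_2(Y)$; (3) for some $k>0$, $c_1(Y)(A)=k\,\omega(A)$ for all $A\in\pi_2(Y)$; (4) the smallest positive value of $c_1(Y)$ on $\pi_2(Y)$ is $\ge n-2$. $\mathbb{K}=\{\sum n_jT^{a_j}:a_j\in\mathbb{R},a_j\to\infty,n_j\in\mathbb{B}\}$ is the Novikov field over a base field $\mathbb{B}$. $QH^*(Y)=H^*(Y;\mathbb{K})\cong H^*(Y;\mathbb{B})\otimes_{\mathbb{B}}\mathbb{K}$ with quantum product $\star$, a deformation of cup product by terms with strictly positive powers of $T$. A slope $\lambda>0$ is *generic* if it is not a period of a non-constant $S^1$-orbit. $H_\lambda$ denotes a Hamiltonian equal to $\lambda H$ at infinity (up to a constant); $HF^*(H_\lambda)$ is its Hamiltonian Floer cohomology over $\mathbb{K}$. For $\delta>0$ smaller than all periods of non-constant $S^1$-orbits, $QH^*(Y)\cong HF^*(H_\delta)$ (PSS), and $c_\lambda^*:QH^*(Y)\cong HF^*(H_\delta)\to HF^*(H_\lambda)$ is the composite with the continuation map. The filtration by quantum-product ideals is $\mathcal{F}^\varphi_p:=\bigcap_{\text{generic }\lambda\ge p}\ker c_\lambda^*$ for $p\in\mathbb{R}$,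 and $\mathcal{F}^\varphi_\infty:=QH^*(Y)$. **Initial part.** For $0\ne x\in H^*(Y;\mathbb{B})\otimes_{\mathbb{B}}\mathbb{K}$ write $x=n_0T^{a_0}+(\text{terms with powers}>a_0)$ with $0\ne n_0\in H^*(Y;\mathbb{B})$; set $\mathrm{ini}(x):=n_0$, $\mathrm{ini}(0):=0$, and $\mathrm{ini}(S):=\{\mathrm{ini}(s):s\in S\}$ for a subset $S$. *)

theory Defs
  imports "HOL-Complex_Analysis.Complex_Analysis" "HOL-Homology.Simplices" "HOL-Library.Extended_Nat"
begin

section \<open>Novikov series\<close>

text \<open>A series \<open>\<Sum> x\<^sub>a T\<^sup>a\<close> is its coefficient function \<open>a \<mapsto> x\<^sub>a\<close>: below every bound there are
  only finitely many exponents. \<open>conv s\<close> is the product of a scalar series with a series of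
  vectors, where \<open>s\<close> is the scalar multiplication; \<open>conv (*)\<close> multiplies scalar series.\<close>

definition left_finite :: "(real \<Rightarrow> 'a::zero) \<Rightarrow> bool" where
  "left_finite x \<longleftrightarrow> (\<forall>c. finite {a. x a \<noteq> 0 \<and> a \<le> c})"

definition conv :: "('b::zero \<Rightarrow> 'v \<Rightarrow> 'v::comm_monoid_add) \<Rightarrow> (real \<Rightarrow> 'b) \<Rightarrow> (real \<Rightarrow> 'v) \<Rightarrow> real \<Rightarrow> 'v" where
  "conv s k x a = (\<Sum>b | k b \<noteq> 0 \<and> x (a - b) \<noteq> 0. s (k b) (x (a - b)))"

lemma left_finite_lower: assumes "left_finite x" obtains m where "\<And>a. x a \<noteq> 0 \<Longrightarrow> m \<le> a"
proof -
  let ?F = "insert 0 {a. x a \<noteq> 0 \<and> a \<le> 0}"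
  have "finite ?F" using assms by (simp add: left_finite_def)
  then have "Min ?F \<le> a" if "x a \<noteq> 0" for a
    using that by (cases "a \<le> 0") (auto intro: Min_le order.trans[OF Min_le[of ?F 0]])
  then show ?thesis using that by blast
qed

lemma left_finite_0: "left_finite (\<lambda>_. 0)" by (simp add: left_finite_def)

lemma left_finite_add:
  fixes x y :: "real \<Rightarrow> 'a::monoid_add"
  assumes "left_finite x" "left_finite y" shows "left_finite (\<lambda>a. x a + y a)"
  unfolding left_finite_def
proof
  fix c
  have "finite ({a. x a \<noteq> 0 \<and> a \<le> c} \<union> {a. y a \<noteq> 0 \<and> a \<le> c})"
    using assms by (simp add: left_finite_def)
  then show "finite {a. x a + y a \<noteq> 0 \<and> a \<le> c}" by (rule rev_finite_subset) auto
qed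

lemma left_finite_uminus:
  fixes x :: "real \<Rightarrow> 'a::group_add"
  shows "left_finite x \<Longrightarrow> left_finite (\<lambda>a. - x a)" by (simp add: left_finite_def)

lemma left_finite_minus:
  fixes x y :: "real \<Rightarrow> 'a::group_add"
  assumes "left_finite x" "left_finite y" shows "left_finite (\<lambda>a. x a - y a)"
  using left_finite_add[OF assms(1) left_finite_uminus[OF assms(2)]] by simp

lemma left_finite_single: "left_finite (\<lambda>a. if a = c then b else 0)"
  unfolding left_finite_def by (auto intro: finite_subset[of _ "{c}"])

context Modules.module
begin

lemma conv_support_finite:
  assumes "left_finite k" "left_finite x" shows "finite {b. k b \<noteq> 0 \<and> x (a - b) \<noteq> 0}"
proof -
  obtain m where m: "\<And>a. x a \<noteq> 0 \<Longrightarrow> m \<le> a" using left_finite_lower[OF assms(2)] by blast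
  have "finite {b. k b \<noteq> 0 \<and> b \<le> a - m}" using assms(1) by (simp add: left_finite_def)
  then show ?thesis by (rule rev_finite_subset) (use m in fastforce)
qed

lemma conv_eq:
  assumes "finite T" "\<And>b. k b \<noteq> 0 \<Longrightarrow> x (a - b) \<noteq> 0 \<Longrightarrow> b \<in> T"
  shows "conv scale k x a = (\<Sum>b\<in>T. scale (k b) (x (a - b)))"
  unfolding conv_def by (rule sum.mono_neutral_left) (use assms in auto)

lemma conv_neq0:
  assumes "conv scale k x a \<noteq> 0" obtains b where "k b \<noteq> 0" "x (a - b) \<noteq> 0"
proof (rule ccontr)
  assume "\<not> thesis"
  then have "{b. k b \<noteq> 0 \<and> x (a - b) \<noteq> 0} = {}" using that by blast
  then show False using assms by (simp only: conv_def sum.empty, simp)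
qed

lemma left_finite_conv:
  assumes "left_finite k" "left_finite x" shows "left_finite (conv scale k x)"
  unfolding left_finite_def
proof
  fix c
  obtain m where m: "\<And>a. x a \<noteq> 0 \<Longrightarrow> m \<le> a" using left_finite_lower[OF assms(2)] by blast
  obtain n where n: "\<And>a. k a \<noteq> 0 \<Longrightarrow> n \<le> a" using left_finite_lower[OF assms(1)] by blast
  let ?B = "{b. k b \<noteq> 0 \<and> b \<le> c - m}" and ?C = "{b. x b \<noteq> 0 \<and> b \<le> c - n}"
  have fin: "finite ((\<lambda>(b,d). b + d) ` (?B \<times> ?C))" using assms by (simp add: left_finite_def)
  show "finite {a. conv scale k x a \<noteq> 0 \<and> a \<le> c}"
  proof (rule finite_subset[OF _ fin], clarify)
    fix a assume a: "conv scale k x a \<noteq> 0" "a \<le> c"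
    obtain b where b: "k b \<noteq> 0" "x (a - b) \<noteq> 0" by (rule conv_neq0[OF a(1)])
    then have "(b, a - b) \<in> ?B \<times> ?C" using a(2) m[of "a-b"] n[of b] by auto
    then show "a \<in> (\<lambda>(b,d). b + d) ` (?B \<times> ?C)" by (rule image_eqI[rotated]) simp
  qed
qed

lemma conv_add_left:
  assumes "left_finite k" "left_finite l" "left_finite x"
  shows "conv scale (\<lambda>a. k a + l a) x a = conv scale k x a + conv scale l x a"
proof -
  let ?T = "{b. k b \<noteq> 0 \<and> x (a - b) \<noteq> 0} \<union> {b. l b \<noteq> 0 \<and> x (a - b) \<noteq> 0}"
  have T: "finite ?T" by (rule finite_UnI; rule conv_support_finite; fact)
  have "conv scale k x a = (\<Sum>b\<in>?T. scale (k b) (x (a - b)))"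
    "conv scale l x a = (\<Sum>b\<in>?T. scale (l b) (x (a - b)))"
    "conv scale (\<lambda>a. k a + l a) x a = (\<Sum>b\<in>?T. scale (k b + l b) (x (a - b)))"
    by (rule conv_eq[OF T]; auto)+
  then show ?thesis by (simp add: scale_left_distrib sum.distrib)
qed

lemma conv_add_right:
  assumes "left_finite k" "left_finite x" "left_finite y"
  shows "conv scale k (\<lambda>a. x a + y a) a = conv scale k x a + conv scale k y a"
proof -
  let ?T = "{b. k b \<noteq> 0 \<and> x (a - b) \<noteq> 0} \<union> {b. k b \<noteq> 0 \<and> y (a - b) \<noteq> 0}"
  have T: "finite ?T" by (rule finite_UnI; rule conv_support_finite; fact)
  have "conv scale k x a = (\<Sum>b\<in>?T. scale (k b) (x (a - b)))"
    "conv scale k y a = (\<Sum>b\<in>?T. scale (k b) (y (a - b)))"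
    "conv scale k (\<lambda>a. x a + y a) a = (\<Sum>b\<in>?T. scale (k b) (x (a - b) + y (a - b)))"
    by (rule conv_eq[OF T]; auto)+
  then show ?thesis by (simp add: scale_right_distrib sum.distrib)
qed

lemma conv_single_left: "conv scale (\<lambda>b. if b = c then r else 0) x a = scale r (x (a - c))"
proof -
  have "conv scale (\<lambda>b. if b = c then r else 0) x a
      = (\<Sum>b\<in>{c}. scale (if b = c then r else 0) (x (a - b)))"
    by (rule conv_eq) (simp_all split: if_splits)
  then show ?thesis by simp
qed

lemma conv_one_left: "conv scale (\<lambda>b. if b = 0 then 1 else 0) x = x"
  by (rule ext) (simp add: conv_single_left)

lemma conv_assoc:
  assumes k: "left_finite k" and l: "left_finite l" and x: "left_finite x"
  shows "conv scale (conv (*) k l) x a = conv scale k (conv scale l x) a"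
proof -
  interpret M: Modules.module "(*) :: 'a \<Rightarrow> 'a \<Rightarrow> 'a" by unfold_locales (auto simp: algebra_simps)
  obtain mk where mk: "\<And>a. k a \<noteq> 0 \<Longrightarrow> mk \<le> a" using left_finite_lower[OF k] by blast
  obtain ml where ml: "\<And>a. l a \<noteq> 0 \<Longrightarrow> ml \<le> a" using left_finite_lower[OF l] by blast
  obtain mx where mx: "\<And>a. x a \<noteq> 0 \<Longrightarrow> mx \<le> a" using left_finite_lower[OF x] by blast
  define B where "B = {b. k b \<noteq> 0 \<and> b \<le> a - ml - mx}"
  define C where "C = {c. l c \<noteq> 0 \<and> c \<le> a - mk - mx}"
  define D where "D = (\<lambda>(b,c). b + c) ` (B \<times> C)"
  have fB: "finite B" and fC: "finite C" using k l by (auto simp: B_def C_def left_finite_def)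
  have fD: "finite D" using fB fC by (simp add: D_def)
  have 1: "conv scale k (conv scale l x) a = (\<Sum>b\<in>B. scale (k b) (conv scale l x (a - b)))"
  proof (rule conv_eq[OF fB])
    fix b assume b: "k b \<noteq> 0" "conv scale l x (a - b) \<noteq> 0"
    obtain c where "l c \<noteq> 0" "x (a - b - c) \<noteq> 0" by (rule conv_neq0[OF b(2)])
    with b ml[of c] mx[of "a - b - c"] show "b \<in> B" by (auto simp: B_def)
  qed
  have 2: "conv scale l x (a - b) = (\<Sum>c\<in>C. scale (l c) (x (a - b - c)))" if "b \<in> B" for b
  proof (rule conv_eq[OF fC])
    fix c assume "l c \<noteq> 0" "x (a - b - c) \<noteq> 0"
    then show "c \<in> C" using that mk[of b] mx[of "a - b - c"] by (auto simp: B_def C_def)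
  qed
  have 3: "conv scale (conv (*) k l) x a = (\<Sum>d\<in>D. scale (conv (*) k l d) (x (a - d)))"
  proof (rule conv_eq[OF fD])
    fix d assume d: "conv (*) k l d \<noteq> 0" "x (a - d) \<noteq> 0"
    obtain b where b: "k b \<noteq> 0" "l (d - b) \<noteq> 0" by (rule M.conv_neq0[OF d(1)])
    then have "(b, d - b) \<in> B \<times> C" using mk[of b] ml[of "d - b"] mx[of "a - d"] d by (auto simp: B_def C_def)
    then show "d \<in> D" unfolding D_def by (rule image_eqI[rotated]) simp
  qed
  have 4: "scale (conv (*) k l d) (x (a - d)) = (\<Sum>b\<in>B. scale (k b * l (d - b)) (x (a - d)))" if "d \<in> D" for d
  proof (cases "x (a - d) = 0")
    case False
    have "conv (*) k l d = (\<Sum>b\<in>B. k b * l (d - b))"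
    proof (rule M.conv_eq[OF fB])
      fix b assume "k b \<noteq> 0" "l (d - b) \<noteq> 0"
      then show "b \<in> B" using ml[of "d - b"] mx[of "a - d"] False by (auto simp: B_def)
    qed
    then show ?thesis by (simp add: scale_sum_left)
  qed simp
  have 5: "(\<Sum>d\<in>D. scale (k b * l (d - b)) (x (a - d))) = (\<Sum>c\<in>C. scale (k b * l c) (x (a - b - c)))" if b: "b \<in> B" for b
  proof -
    have "(\<Sum>d\<in>D. scale (k b * l (d - b)) (x (a - d))) = (\<Sum>d\<in>(\<lambda>c. b + c) ` C. scale (k b * l (d - b)) (x (a - d)))"
    proof (rule sum.mono_neutral_right[OF fD])
      show "(\<lambda>c. b + c) ` C \<subseteq> D" unfolding D_def using b by force
      show "\<forall>d\<in>D - (\<lambda>c. b + c) ` C. scale (k b * l (d - b)) (x (a - d)) = 0"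
      proof (rule ballI, rule ccontr)
        fix d assume d: "d \<in> D - (\<lambda>c. b + c) ` C" and n: "scale (k b * l (d - b)) (x (a - d)) \<noteq> 0"
        then have "l (d - b) \<noteq> 0" "x (a - d) \<noteq> 0" by auto
        then have "d - b \<in> C" using b mk[of b] mx[of "a - d"] by (auto simp: B_def C_def)
        then have "d \<in> (\<lambda>c. b + c) ` C" by (rule image_eqI[rotated]) simp
        then show False using d by blast
      qed
    qed
    also have "\<dots> = (\<Sum>c\<in>C. scale (k b * l c) (x (a - b - c)))"
      by (subst sum.reindex) (auto simp: o_def diff_diff_eq)
    finally show ?thesis .
  qed
  have "conv scale (conv (*) k l) x a = (\<Sum>d\<in>D. \<Sum>b\<in>B. scale (k b * l (d - b)) (x (a - d)))"
    unfolding 3 by (rule sum.cong) (simp_all add: 4)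
  also have "\<dots> = (\<Sum>b\<in>B. \<Sum>c\<in>C. scale (k b * l c) (x (a - b - c)))"
    by (subst sum.swap) (rule sum.cong, simp_all add: 5)
  also have "\<dots> = conv scale k (conv scale l x) a"
    unfolding 1 by (rule sum.cong) (simp_all add: 2 scale_sum_right)
  finally show ?thesis .
qed

end

interpretation mult_module: Modules.module "(*) :: 'a::comm_ring_1 \<Rightarrow> 'a \<Rightarrow> 'a"
  by unfold_locales (auto simp: algebra_simps)

lemma conv_commute:
  fixes k l :: "real \<Rightarrow> 'a::comm_ring_1"
  shows "conv (*) k l a = conv (*) l k a"
  unfolding conv_def
  by (rule sum.reindex_bij_witness[where i="\<lambda>b. a - b" and j="\<lambda>b. a - b"]) (auto simp: mult.commute)

typedef (overloaded) 'b novikov = "{x :: real \<Rightarrow> 'b::zero. left_finite x}"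
  morphisms ncoeff Novikov
  using left_finite_0 by blast

setup_lifting type_definition_novikov

instantiation novikov :: (field) comm_ring_1
begin
lift_definition zero_novikov :: "'a novikov" is "\<lambda>_. 0" by (rule left_finite_0)
lift_definition one_novikov :: "'a novikov" is "\<lambda>a. if a = 0 then 1 else 0" by (rule left_finite_single)
lift_definition plus_novikov :: "'a novikov \<Rightarrow> 'a novikov \<Rightarrow> 'a novikov" is "\<lambda>x y a. x a + y a" by (rule left_finite_add)
lift_definition uminus_novikov :: "'a novikov \<Rightarrow> 'a novikov" is "\<lambda>x a. - x a" by (rule left_finite_uminus)
lift_definition minus_novikov :: "'a novikov \<Rightarrow> 'a novikov \<Rightarrow> 'a novikov" is "\<lambda>x y a. x a - y a" by (rule left_finite_minus)
lift_definition times_novikov :: "'a novikov \<Rightarrow> 'a novikov \<Rightarrow> 'a novikov" is "conv (*)" by (rule mult_module.left_finite_conv)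
instance
proof
  fix a b c :: "'a novikov"
  show "a * b * c = a * (b * c)" by transfer (rule ext, rule mult_module.conv_assoc)
  show "a * b = b * a" by transfer (rule ext, rule conv_commute)
  show "1 * a = a" by transfer (rule mult_module.conv_one_left)
  show "(a + b) * c = a * c + b * c" by transfer (rule ext, rule mult_module.conv_add_left)
  show "(0::'a novikov) \<noteq> 1" by transfer (metis zero_neq_one)
  show "a + b + c = a + (b + c)" by transfer (simp add: add.assoc)
  show "a + b = b + a" by transfer (simp add: add.commute)
  show "0 + a = a" by transfer simp
  show "- a + a = 0" by transfer simp
  show "a - b = a + - b" by transfer simp
qed
end

lemma ncoeff_eqI: "(\<And>a. ncoeff x a = ncoeff y a) \<Longrightarrow> x = y"
  by (simp add: ncoeff_inject[symmetric] fun_eq_iff)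

lift_definition nmonom :: "real \<Rightarrow> 'b::field \<Rightarrow> 'b novikov" is "\<lambda>c r a. if a = c then r else 0"
  by (rule left_finite_single)

lemma ncoeff_power_low:
  fixes e :: "'b::field novikov"
  assumes "\<And>a. ncoeff e a \<noteq> 0 \<Longrightarrow> \<epsilon> \<le> a"
  shows "ncoeff (e ^ n) a \<noteq> 0 \<Longrightarrow> real n * \<epsilon> \<le> a"
proof (induction n arbitrary: a)
  case 0 then show ?case by (simp add: one_novikov.rep_eq split: if_splits)
next
  case (Suc n)
  then obtain b where "ncoeff e b \<noteq> 0" "ncoeff (e ^ n) (a - b) \<noteq> 0"
    by (auto simp: times_novikov.rep_eq elim: mult_module.conv_neq0)
  with Suc.IH[of "a - b"] assms[of b] show ?case by (simp add: algebra_simps)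
qed

lemma ncoeff_sum: "ncoeff (sum f A) a = (\<Sum>i\<in>A. ncoeff (f i) a)" for f :: "_ \<Rightarrow> 'b::field novikov"
  by (induction A rule: infinite_finite_induct) (auto simp: zero_novikov.rep_eq plus_novikov.rep_eq)

lemma one_minus_inverse:
  fixes e :: "'b::field novikov"
  assumes \<epsilon>: "\<epsilon> > 0" and e: "\<And>a. ncoeff e a \<noteq> 0 \<Longrightarrow> \<epsilon> \<le> a"
  shows "\<exists>y. (1 - e) * y = 1"
proof -
  define N where "N c = nat \<lceil>c / \<epsilon>\<rceil> + 1" for c
  have N: "ncoeff (e ^ n) a = 0" if "a \<le> c" "N c \<le> n" for n a c
  proof (rule ccontr)
    assume "ncoeff (e ^ n) a \<noteq> 0"
    then have "real n * \<epsilon> \<le> c" using ncoeff_power_low[OF e] that by fastforce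
    then have "real n \<le> c / \<epsilon>" using \<epsilon> by (simp add: pos_le_divide_eq)
    with that(2) show False unfolding N_def by linarith
  qed
  define P where "P n = (\<Sum>i<n. e ^ i)" for n
  have P: "ncoeff (P m) a = ncoeff (P (N c)) a" if "a \<le> c" "N c \<le> m" for m a c
  proof -
    have "(\<Sum>i<m. ncoeff (e ^ i) a) = (\<Sum>i<N c. ncoeff (e ^ i) a)"
      by (rule sum.mono_neutral_right) (use that N[OF that(1)] in auto)
    then show ?thesis by (simp add: P_def ncoeff_sum)
  qed
  define y where "y a = ncoeff (P (N a)) a" for a
  have y: "y a = ncoeff (P (N c)) a" if "a \<le> c" for a c
  proof -
    have "N a \<le> N c" unfolding N_def using that \<epsilon>
      by (simp add: ceiling_mono divide_right_mono nat_mono del: nat_ceiling_le_eq)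
    then show ?thesis using P[of a a "N c"] by (simp add: y_def)
  qed
  have lf: "left_finite y" unfolding left_finite_def
  proof
    fix c
    have "{a. y a \<noteq> 0 \<and> a \<le> c} = {a. ncoeff (P (N c)) a \<noteq> 0 \<and> a \<le> c}" using y by auto
    then show "finite {a. y a \<noteq> 0 \<and> a \<le> c}" using ncoeff[of "P (N c)"] by (simp add: left_finite_def)
  qed
  define Y where "Y = Novikov y"
  have Y: "ncoeff Y = y" unfolding Y_def using lf by (simp add: Novikov_inverse)
  have "ncoeff ((1 - e) * Y) a = ncoeff 1 a" for a
  proof -
    have agree: "y (a - b) = ncoeff (P (N a)) (a - b)" if "ncoeff (1 - e) b \<noteq> 0" for b
    proof (rule y)
      have "b = 0 \<or> ncoeff e b \<noteq> 0"
        using that by (auto simp: minus_novikov.rep_eq one_novikov.rep_eq)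
      then have "0 \<le> b" using e[of b] \<epsilon> by linarith
      then show "a - b \<le> a" by simp
    qed
    have "ncoeff ((1 - e) * Y) a = ncoeff ((1 - e) * P (N a)) a"
      unfolding times_novikov.rep_eq conv_def Y
      by (rule sum.cong) (simp_all add: agree cong: conj_cong)
    also have "(1 - e) * P (N a) = 1 - e ^ N a" unfolding P_def
      by (simp add: one_diff_power_eq)
    also have "ncoeff (1 - e ^ N a) a = ncoeff 1 a" using N[of a a "N a"] by (simp add: minus_novikov.rep_eq)
    finally show ?thesis .
  qed
  then have "(1 - e) * Y = 1" by (rule ncoeff_eqI)
  then show ?thesis ..
qed

lemma nmonom_mult: "nmonom a r * nmonom b s = nmonom (a + b) (r * s)"
  by (rule ncoeff_eqI) (auto simp: times_novikov.rep_eq nmonom.rep_eq mult_module.conv_single_left)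

lemma novikov_inverse_exists:
  fixes x :: "'b::field novikov" assumes "x \<noteq> 0" shows "\<exists>y. x * y = 1"
proof -
  obtain a1 where a1: "ncoeff x a1 \<noteq> 0" using assms by (metis ncoeff_eqI zero_novikov.rep_eq)
  have fin: "finite {a. ncoeff x a \<noteq> 0 \<and> a \<le> c}" for c using ncoeff[of x] by (simp add: left_finite_def)
  define a0 where "a0 = Min {a. ncoeff x a \<noteq> 0 \<and> a \<le> a1}"
  have "a0 \<in> {a. ncoeff x a \<noteq> 0 \<and> a \<le> a1}" unfolding a0_def by (rule Min_in[OF fin]) (use a1 in auto)
  then have a0: "ncoeff x a0 \<noteq> 0" "a0 \<le> a1" by auto
  have min: "a0 \<le> a" if "ncoeff x a \<noteq> 0" for a
    using that a0(2) Min_le[OF fin, of a a1] unfolding a0_def by (cases "a \<le> a1") auto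
  define u where "u = nmonom (- a0) (inverse (ncoeff x a0)) * x"
  have u: "ncoeff u a = inverse (ncoeff x a0) * ncoeff x (a + a0)" for a
    by (simp add: u_def times_novikov.rep_eq nmonom.rep_eq mult_module.conv_single_left)
  define e where "e = 1 - u"
  have e: "ncoeff e a = (if a = 0 then 0 else - ncoeff u a)" for a
    using a0 by (simp add: e_def minus_novikov.rep_eq one_novikov.rep_eq u)
  define S where "S = insert 1 {a. ncoeff e a \<noteq> 0 \<and> a \<le> 1}"
  have fS: "finite S" using ncoeff[of e] by (simp add: left_finite_def S_def)
  have pos: "0 < a" if "ncoeff e a \<noteq> 0" for a
    using that min[of "a + a0"] by (auto simp: e u split: if_splits)
  have eps: "0 < Min S" using fS pos by (subst Min_gr_iff) (auto simp: S_def)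
  have low: "Min S \<le> a" if "ncoeff e a \<noteq> 0" for a
  proof (cases "a \<le> 1")
    case True then show ?thesis using that fS by (auto simp: S_def intro: Min_le)
  next
    case False
    have "Min S \<le> 1" using fS by (auto simp: S_def intro: Min_le)
    with False show ?thesis by simp
  qed
  have "\<exists>y. (1 - e) * y = 1" by (rule one_minus_inverse[OF eps]) (rule low)
  then obtain y where "(1 - e) * y = 1" ..
  moreover have "1 - e = u" by (simp add: e_def)
  ultimately have "u * y = 1" by simp
  moreover have "u * y = x * (nmonom (- a0) (inverse (ncoeff x a0)) * y)"
    by (simp only: u_def mult.assoc mult.left_commute)
  ultimately have "x * (nmonom (- a0) (inverse (ncoeff x a0)) * y) = 1" by simp
  then show ?thesis ..
qed

instantiation novikov :: (field) field
begin
definition inverse_novikov :: "'a novikov \<Rightarrow> 'a novikov" where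
  "inverse_novikov x = (if x = 0 then 0 else SOME y. x * y = 1)"
definition divide_novikov :: "'a novikov \<Rightarrow> 'a novikov \<Rightarrow> 'a novikov" where
  "divide_novikov x y = x * inverse y"
instance
proof
  fix x y :: "'a novikov"
  show "inverse x * x = 1" if "x \<noteq> 0"
    using someI_ex[OF novikov_inverse_exists[OF that]] that by (simp add: inverse_novikov_def mult.commute)
  show "x div y = x * inverse y" by (simp add: divide_novikov_def)
  show "inverse (0::'a novikov) = 0" by (simp add: inverse_novikov_def)
qed
end


section \<open>Singular cohomology with field coefficients and the cup product\<close>

text \<open>Cochains are families indexed by the degree, extended by zero off the singular
  simplices; the total complex is the direct sum over all degrees.\<close>

type_synonym ('y, 'b) cochain = "nat \<Rightarrow> ((nat \<Rightarrow> real) \<Rightarrow> 'y) \<Rightarrow> 'b"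

definition is_cochain :: "('y::topological_space, 'b::field) cochain \<Rightarrow> bool" where
  "is_cochain c \<longleftrightarrow> (\<forall>p s. \<not> singular_simplex p euclidean s \<longrightarrow> c p s = 0) \<and> finite {p. c p \<noteq> (\<lambda>_. 0)}"

definition coboundary :: "('y::topological_space, 'b::field) cochain \<Rightarrow> ('y, 'b) cochain" where
  "coboundary c p s =
    (if p = 0 \<or> \<not> singular_simplex p euclidean s then 0
     else \<Sum>k\<le>p. (- 1) ^ k * c (p - 1) (singular_face p k s))"

definition is_cocycle :: "('y::topological_space, 'b::field) cochain \<Rightarrow> bool" where
  "is_cocycle c \<longleftrightarrow> is_cochain c \<and> coboundary c = (\<lambda>_ _. 0)"

definition cohomologous :: "('y::topological_space, 'b::field) cochain \<Rightarrow> ('y, 'b) cochain \<Rightarrow> bool" where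
  "cohomologous a b \<longleftrightarrow> is_cocycle a \<and> is_cocycle b \<and>
    (\<exists>c. is_cochain c \<and> (\<forall>p s. a p s - b p s = coboundary c p s))"

lemma is_cochain_0: "is_cochain (\<lambda>_ _. 0)" by (simp add: is_cochain_def)

lemma is_cochain_add:
  assumes a: "is_cochain a" and b: "is_cochain b"
  shows "is_cochain (\<lambda>p s. a p s + b p s)"
proof -
  have "finite ({p. a p \<noteq> (\<lambda>_. 0)} \<union> {p. b p \<noteq> (\<lambda>_. 0)})"
    using a b by (simp add: is_cochain_def)
  then have "finite {p. (\<lambda>s. a p s + b p s) \<noteq> (\<lambda>_. 0)}"
    by (rule rev_finite_subset) auto
  then show ?thesis using a b by (simp add: is_cochain_def)
qed

lemma is_cochain_scale:
  assumes a: "is_cochain a" shows "is_cochain (\<lambda>p s. r * a p s)"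
proof -
  have "finite {p. a p \<noteq> (\<lambda>_. 0)}" using a by (simp add: is_cochain_def)
  then have "finite {p. (\<lambda>s. r * a p s) \<noteq> (\<lambda>_. 0)}"
    by (rule rev_finite_subset) auto
  then show ?thesis using a by (simp add: is_cochain_def)
qed

lemma coboundary_0: "coboundary (\<lambda>_ _. 0) = (\<lambda>_ _. 0)"
  by (simp add: coboundary_def fun_eq_iff)

lemma coboundary_add: "coboundary (\<lambda>p s. a p s + b p s) p s = coboundary a p s + coboundary b p s"
  unfolding coboundary_def by (simp only: distrib_left sum.distrib split: if_split) simp

lemma coboundary_scale: "coboundary (\<lambda>p s. r * a p s) p s = r * coboundary a p s"
  unfolding coboundary_def sum_distrib_left[symmetric] mult.left_commute[of _ r]
  by (simp only: mult_zero_right split: if_split) simp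

lemma is_cocycle_0: "is_cocycle (\<lambda>_ _. 0)" by (simp add: is_cocycle_def is_cochain_0 coboundary_0)

lemma is_cocycle_add: "is_cocycle a \<Longrightarrow> is_cocycle b \<Longrightarrow> is_cocycle (\<lambda>p s. a p s + b p s)"
  by (simp add: is_cocycle_def is_cochain_add fun_eq_iff coboundary_add)

lemma is_cocycle_scale: "is_cocycle a \<Longrightarrow> is_cocycle (\<lambda>p s. r * a p s)"
  by (simp add: is_cocycle_def is_cochain_scale fun_eq_iff coboundary_scale)

lemma cohomologousI:
  assumes "is_cocycle a" "is_cocycle b" "is_cochain c" "\<And>p s. a p s - b p s = coboundary c p s"
  shows "cohomologous a b"
  using assms unfolding cohomologous_def by blast

lemma cohomologousE:
  assumes "cohomologous a b"
  obtains c where "is_cocycle a" "is_cocycle b" "is_cochain c" "\<forall>p s. a p s - b p s = coboundary c p s"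
  using assms unfolding cohomologous_def by blast

lemma cohomologous_refl: "is_cocycle a \<Longrightarrow> cohomologous a a"
  by (rule cohomologousI[OF _ _ is_cochain_0]) (simp_all add: coboundary_0)

lemma cohomologous_eqI: "cohomologous a a \<Longrightarrow> (\<And>p s. b p s = a p s) \<Longrightarrow> cohomologous b a"
proof -
  assume a: "cohomologous a a" and "\<And>p s. b p s = a p s"
  then have "b = a" by (intro ext)
  then show "cohomologous b a" using a by simp
qed

lemma cohomologous_add:
  assumes "cohomologous a b" "cohomologous a' b'"
  shows "cohomologous (\<lambda>p s. a p s + a' p s) (\<lambda>p s. b p s + b' p s)"
proof -
  obtain c where c: "is_cocycle a" "is_cocycle b" "is_cochain c" "\<forall>p s. a p s - b p s = coboundary c p s"
    using assms(1) by (rule cohomologousE)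
  obtain d where d: "is_cocycle a'" "is_cocycle b'" "is_cochain d" "\<forall>p s. a' p s - b' p s = coboundary d p s"
    using assms(2) by (rule cohomologousE)
  show ?thesis
    by (rule cohomologousI[OF is_cocycle_add[OF c(1) d(1)] is_cocycle_add[OF c(2) d(2)] is_cochain_add[OF c(3) d(3)]])
      (simp only: coboundary_add c(4)[rule_format, symmetric] d(4)[rule_format, symmetric] add_diff_add)
qed

lemma cohomologous_scale:
  assumes "cohomologous a b" shows "cohomologous (\<lambda>p s. r * a p s) (\<lambda>p s. r * b p s)"
proof -
  obtain c where c: "is_cocycle a" "is_cocycle b" "is_cochain c" "\<forall>p s. a p s - b p s = coboundary c p s"
    using assms by (rule cohomologousE)
  show ?thesis
    by (rule cohomologousI[OF is_cocycle_scale[OF c(1)] is_cocycle_scale[OF c(2)] is_cochain_scale[OF c(3)]])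
      (simp only: coboundary_scale c(4)[rule_format, symmetric] right_diff_distrib)
qed

lemma cohomologous_sym: assumes "cohomologous a b" shows "cohomologous b a"
proof -
  obtain c where c: "is_cocycle a" "is_cocycle b" "is_cochain c" "\<forall>p s. a p s - b p s = coboundary c p s"
    using assms by (rule cohomologousE)
  show ?thesis
    by (rule cohomologousI[OF c(2) c(1) is_cochain_scale[OF c(3), of "- 1"]])
      (simp only: coboundary_scale c(4)[rule_format, symmetric], simp)
qed

lemma cohomologous_trans: assumes "cohomologous a b" "cohomologous b d" shows "cohomologous a d"
proof -
  obtain c where c: "is_cocycle a" "is_cocycle b" "is_cochain c" "\<forall>p s. a p s - b p s = coboundary c p s"
    using assms(1) by (rule cohomologousE)
  obtain e where e: "is_cocycle b" "is_cocycle d" "is_cochain e" "\<forall>p s. b p s - d p s = coboundary e p s"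
    using assms(2) by (rule cohomologousE)
  show ?thesis
    by (rule cohomologousI[OF c(1) e(2) is_cochain_add[OF c(3) e(3)]])
      (simp only: coboundary_add c(4)[rule_format, symmetric] e(4)[rule_format, symmetric], simp)
qed

text \<open>The type \<open>('y, 'b) coh\<close> is the total cohomology of the whole space \<open>'y\<close>,
  with coefficients in \<open>'b\<close>.\<close>

quotient_type (overloaded) ('y, 'b) coh = "('y::topological_space, 'b::field) cochain" / partial: cohomologous
proof (rule part_equivpI)
  show "\<exists>x. cohomologous x x" using cohomologous_refl[OF is_cocycle_0] by blast
  show "symp cohomologous" by (rule sympI) (rule cohomologous_sym)
  show "transp cohomologous" by (rule transpI) (rule cohomologous_trans)
qed

instantiation coh :: (topological_space, field) ab_group_add
begin
lift_definition zero_coh :: "('a, 'b) coh" is "\<lambda>_ _. 0" by (rule cohomologous_refl[OF is_cocycle_0])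
lift_definition plus_coh :: "('a, 'b) coh \<Rightarrow> ('a, 'b) coh \<Rightarrow> ('a, 'b) coh" is "\<lambda>a b p s. a p s + b p s"
  by (rule cohomologous_add)
lift_definition uminus_coh :: "('a, 'b) coh \<Rightarrow> ('a, 'b) coh" is "\<lambda>a p s. (- 1) * a p s"
  by (rule cohomologous_scale)
definition minus_coh :: "('a, 'b) coh \<Rightarrow> ('a, 'b) coh \<Rightarrow> ('a, 'b) coh" where
  "minus_coh a b = a + - b"
instance
proof
  fix a b c :: "('a, 'b) coh"
  show "a + b + c = a + (b + c)"
    by transfer (rule cohomologous_eqI, intro cohomologous_add, auto simp: add.assoc)
  show "a + b = b + a"
    by transfer (rule cohomologous_eqI, intro cohomologous_add, auto simp: add.commute)
  show "0 + a = a"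
    by transfer (rule cohomologous_eqI, auto)
  show "- a + a = 0"
    by transfer (rule cohomologous_eqI, auto intro: cohomologous_refl is_cocycle_0)
  show "a - b = a + - b" by (simp add: minus_coh_def)
qed
end

lift_definition coh_scale :: "'b \<Rightarrow> ('y::topological_space, 'b::field) coh \<Rightarrow> ('y, 'b) coh" is "\<lambda>r a p s. r * a p s"
  by (rule cohomologous_scale)

context Vector_Spaces.vector_space
begin

text \<open>Rank with value \<open>\<infinity>\<close> for infinite-dimensional spaces
  (the library's \<open>dim\<close> is 0 there).\<close>

definition rank :: "'b set \<Rightarrow> enat" where
  "rank S = (if \<exists>B. finite B \<and> span B = span S then enat (dim S) else \<infinity>)"

end

lemma cohomologous_scale_laws:
  fixes a b :: "('y::topological_space, 'b::field) cochain"
  assumes a: "cohomologous a a" and b: "cohomologous b b"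
  shows "cohomologous (\<lambda>p s. r * (a p s + b p s)) (\<lambda>p s. r * a p s + r * b p s)"
    and "cohomologous (\<lambda>p s. (r + t) * a p s) (\<lambda>p s. r * a p s + t * a p s)"
    and "cohomologous (\<lambda>p s. r * (t * a p s)) (\<lambda>p s. r * t * a p s)"
    and "cohomologous (\<lambda>p s. 1 * a p s) a"
proof -
  show "cohomologous (\<lambda>p s. r * (a p s + b p s)) (\<lambda>p s. r * a p s + r * b p s)"
    unfolding distrib_left by (rule cohomologous_add[OF cohomologous_scale[OF a] cohomologous_scale[OF b]])
  show "cohomologous (\<lambda>p s. (r + t) * a p s) (\<lambda>p s. r * a p s + t * a p s)"
    unfolding distrib_right by (rule cohomologous_add[OF cohomologous_scale[OF a] cohomologous_scale[OF a]])
  show "cohomologous (\<lambda>p s. r * (t * a p s)) (\<lambda>p s. r * t * a p s)"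
    unfolding mult.assoc by (rule cohomologous_scale[OF cohomologous_scale[OF a]])
  show "cohomologous (\<lambda>p s. 1 * a p s) a"
    using a by simp
qed

interpretation coh: Vector_Spaces.vector_space
  "coh_scale :: 'b::field \<Rightarrow> ('y::topological_space, 'b) coh \<Rightarrow> ('y, 'b) coh"
proof
  fix r t :: 'b and a b :: "('y, 'b) coh"
  show "coh_scale r (a + b) = coh_scale r a + coh_scale r b"
    by transfer (rule cohomologous_scale_laws(1))
  show "coh_scale (r + t) a = coh_scale r a + coh_scale t a"
    by transfer (rule cohomologous_scale_laws(2))
  show "coh_scale r (coh_scale t a) = coh_scale (r * t) a"
    by transfer (rule cohomologous_scale_laws(3))
  show "coh_scale 1 a = a"
    by transfer (rule cohomologous_scale_laws(4))
qed

text \<open>Front and back faces of a simplex; together they give the Alexander--Whitney formula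
  for the cup product.\<close>

definition front_face :: "nat \<Rightarrow> ((nat \<Rightarrow> real) \<Rightarrow> 'y) \<Rightarrow> (nat \<Rightarrow> real) \<Rightarrow> 'y" where
  "front_face p s = restrict s (standard_simplex p)"

definition back_face :: "nat \<Rightarrow> nat \<Rightarrow> ((nat \<Rightarrow> real) \<Rightarrow> 'y) \<Rightarrow> (nat \<Rightarrow> real) \<Rightarrow> 'y" where
  "back_face p q s = restrict (\<lambda>x. s (\<lambda>i. if i < p then 0 else x (i - p))) (standard_simplex q)"

definition cup_cochain ::
  "('y::topological_space, 'b::field) cochain \<Rightarrow> ('y, 'b) cochain \<Rightarrow> ('y, 'b) cochain" where
  "cup_cochain a b r s =
    (if singular_simplex r euclidean s
     then \<Sum>p\<le>r. a p (front_face p s) * b (r - p) (back_face p (r - p) s) else 0)"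

text \<open>By the Leibniz rule the class does not depend on the representatives.\<close>

definition cup :: "('y::topological_space, 'b::field) coh \<Rightarrow> ('y, 'b) coh \<Rightarrow> ('y, 'b) coh" (infixl "\<smile>" 70) where
  "x \<smile> y = abs_coh (cup_cochain (rep_coh x) (rep_coh y))"

definition unit_coh :: "('y::topological_space, 'b::field) coh" where
  "unit_coh = abs_coh (\<lambda>p s. if p = 0 \<and> singular_simplex 0 euclidean s then 1 else 0)"

definition coh_parity :: "nat \<Rightarrow> ('y::topological_space, 'b::field) coh set" where
  "coh_parity i = {abs_coh c | c. is_cocycle c \<and> (\<forall>p. p mod 2 \<noteq> i mod 2 \<longrightarrow> c p = (\<lambda>_. 0))}"

definition cup_ideal :: "('y::topological_space, 'b::field) coh set \<Rightarrow> bool" where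
  "cup_ideal J \<longleftrightarrow> coh.subspace J \<and> (\<forall>h. \<forall>x\<in>J. h \<smile> x \<in> J \<and> x \<smile> h \<in> J)"


section \<open>The module underlying quantum cohomology\<close>

text \<open>The algebraic tensor product of cohomology with the Novikov field: an element is a
  Novikov series with coefficients in cohomology whose coefficients span a
  finite-dimensional space, that is, a finite sum of elements \<open>h \<otimes> k\<close>.\<close>

typedef (overloaded) ('y, 'b) qh =
  "{x :: real \<Rightarrow> ('y::topological_space, 'b::field) coh.
      left_finite x \<and> (\<exists>B. finite B \<and> range x \<subseteq> coh.span B)}"
  morphisms qcoeff QH
  by (rule exI[of _ "\<lambda>_. 0"]) (auto simp: left_finite_0 coh.span_zero)

setup_lifting type_definition_qh

lemma qh_add_closed:
  fixes x y :: "real \<Rightarrow> ('y::topological_space, 'b::field) coh"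
  assumes "\<exists>B. finite B \<and> range x \<subseteq> coh.span B" "\<exists>B. finite B \<and> range y \<subseteq> coh.span B"
  shows "\<exists>B. finite B \<and> range (\<lambda>a. x a + y a) \<subseteq> coh.span B"
proof -
  obtain B where B: "finite B" "range x \<subseteq> coh.span B" using assms(1) by (elim exE conjE)
  obtain C where C: "finite C" "range y \<subseteq> coh.span C" using assms(2) by (elim exE conjE)
  have "x a + y a \<in> coh.span (B \<union> C)" for a
  proof (rule coh.span_add)
    show "x a \<in> coh.span (B \<union> C)"
      by (rule subsetD[OF coh.span_mono[OF Un_upper1]]) (rule subsetD[OF B(2) rangeI])
    show "y a \<in> coh.span (B \<union> C)"
      by (rule subsetD[OF coh.span_mono[OF Un_upper2]]) (rule subsetD[OF C(2) rangeI])
  qed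
  then have "range (\<lambda>a. x a + y a) \<subseteq> coh.span (B \<union> C)" by (rule image_subsetI)
  with B(1) C(1) show ?thesis by (intro exI[of _ "B \<union> C"] conjI finite_UnI)
qed

lemma qh_uminus_closed:
  fixes x :: "real \<Rightarrow> ('y::topological_space, 'b::field) coh"
  assumes "\<exists>B. finite B \<and> range x \<subseteq> coh.span B"
  shows "\<exists>B. finite B \<and> range (\<lambda>a. - x a) \<subseteq> coh.span B"
proof -
  obtain B where B: "finite B" "range x \<subseteq> coh.span B" using assms by (elim exE conjE)
  have "range (\<lambda>a. - x a) \<subseteq> coh.span B"
    by (rule image_subsetI) (rule coh.span_neg, rule subsetD[OF B(2) rangeI])
  with B(1) show ?thesis by (intro exI[of _ B] conjI)
qed

lemma qh_scale_closed:
  fixes x :: "real \<Rightarrow> ('y::topological_space, 'b::field) coh"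
  assumes "\<exists>B. finite B \<and> range x \<subseteq> coh.span B"
  shows "\<exists>B. finite B \<and> range (conv coh_scale k x) \<subseteq> coh.span B"
proof -
  obtain B where B: "finite B" "range x \<subseteq> coh.span B" using assms by (elim exE conjE)
  have "range (conv coh_scale k x) \<subseteq> coh.span B"
    by (rule image_subsetI)
      (unfold conv_def, rule coh.span_sum, rule coh.span_scale, rule subsetD[OF B(2) rangeI])
  with B(1) show ?thesis by (intro exI[of _ B] conjI)
qed

instantiation qh :: (topological_space, field) ab_group_add
begin
lift_definition zero_qh :: "('a, 'b) qh" is "\<lambda>_. 0" by (auto simp: left_finite_0 coh.span_zero)
lift_definition plus_qh :: "('a, 'b) qh \<Rightarrow> ('a, 'b) qh \<Rightarrow> ('a, 'b) qh" is "\<lambda>x y a. x a + y a"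
  by (elim conjE) (intro conjI left_finite_add qh_add_closed)
lift_definition uminus_qh :: "('a, 'b) qh \<Rightarrow> ('a, 'b) qh" is "\<lambda>x a. - x a"
  by (elim conjE) (intro conjI left_finite_uminus qh_uminus_closed)
definition minus_qh :: "('a, 'b) qh \<Rightarrow> ('a, 'b) qh \<Rightarrow> ('a, 'b) qh" where
  "minus_qh x y = x + - y"
instance
proof
  fix a b c :: "('a, 'b) qh"
  show "a + b + c = a + (b + c)" by transfer (simp add: add.assoc)
  show "a + b = b + a" by transfer (simp add: add.commute)
  show "0 + a = a" by transfer simp
  show "- a + a = 0" by transfer simp
  show "a - b = a + - b" by (simp add: minus_qh_def)
qed
end

lift_definition qh_scale :: "'b novikov \<Rightarrow> ('y::topological_space, 'b::field) qh \<Rightarrow> ('y, 'b) qh"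
  is "\<lambda>k x. conv coh_scale k x"
  by (elim conjE) (intro conjI coh.left_finite_conv qh_scale_closed)

interpretation qh: Vector_Spaces.vector_space
  "qh_scale :: 'b::field novikov \<Rightarrow> ('y::topological_space, 'b) qh \<Rightarrow> ('y, 'b) qh"
proof
  fix r t :: "'b novikov" and a b :: "('y, 'b) qh"
  show "qh_scale r (a + b) = qh_scale r a + qh_scale r b"
    by transfer (rule ext, rule coh.conv_add_right, auto)
  show "qh_scale (r + t) a = qh_scale r a + qh_scale t a"
    by transfer (rule ext, rule coh.conv_add_left, auto)
  show "qh_scale r (qh_scale t a) = qh_scale (r * t) a"
    by transfer (rule ext, rule coh.conv_assoc[symmetric], auto)
  show "qh_scale 1 a = a"
    by transfer (rule coh.conv_one_left)
qed

text \<open>\<open>h \<mapsto> h \<otimes> 1\<close>\<close>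

definition const_qh :: "('y::topological_space, 'b::field) coh \<Rightarrow> ('y, 'b) qh" where
  "const_qh h = QH (\<lambda>a. if a = 0 then h else 0)"

lemma qcoeff_const_qh: "qcoeff (const_qh h) a = (if a = 0 then h else 0)"
proof -
  have "range (\<lambda>a::real. if a = 0 then h else 0) \<subseteq> coh.span {h}"
    by (auto intro: coh.span_base coh.span_zero)
  then have "(\<lambda>a. if a = 0 then h else 0) \<in> {x. left_finite x \<and> (\<exists>B. finite B \<and> range x \<subseteq> coh.span B)}"
    using left_finite_single[of 0 h] by (intro CollectI conjI exI[of _ "{h}"]) auto
  then show ?thesis unfolding const_qh_def by (simp add: QH_inverse)
qed

text \<open>\<open>T\<close> has even degree.\<close>

definition qh_parity :: "nat \<Rightarrow> ('y::topological_space, 'b::field) qh set" where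
  "qh_parity i = {x. \<forall>a. qcoeff x a \<in> coh_parity i}"

definition ini :: "('y::topological_space, 'b::field) qh \<Rightarrow> ('y, 'b) coh" where
  "ini x = (if x = 0 then 0 else qcoeff x (LEAST a. qcoeff x a \<noteq> 0))"

section \<open>Smooth manifolds and tensors\<close>

fun Ck_on :: "nat \<Rightarrow> 'a::real_normed_vector set \<Rightarrow> ('a \<Rightarrow> 'b::real_normed_vector) \<Rightarrow> bool" where
  "Ck_on 0 S f \<longleftrightarrow> continuous_on S f"
| "Ck_on (Suc k) S f \<longleftrightarrow>
     (\<forall>x\<in>S. f differentiable (at x)) \<and> (\<forall>v. Ck_on k S (\<lambda>x. frechet_derivative f (at x) v))"

text \<open>Smoothness on an arbitrary set: existence of a smooth extension to an open
  neighbourhood. This covers manifolds with boundary.\<close>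

definition smooth_on :: "'a::euclidean_space set \<Rightarrow> ('a \<Rightarrow> 'b::real_normed_vector) \<Rightarrow> bool" where
  "smooth_on S f \<longleftrightarrow> (\<exists>T g. open T \<and> S \<subseteq> T \<and> (\<forall>k. Ck_on k T g) \<and> (\<forall>x\<in>S. g x = f x))"

text \<open>The manifold is always the whole type; an atlas is a set of charts (domain, map)
  and need not be maximal.\<close>

type_synonym ('m, 'e) chart = "'m set \<times> ('m \<Rightarrow> 'e)"

abbreviation cdom :: "('m, 'e) chart \<Rightarrow> 'm set" where "cdom \<equiv> fst"
abbreviation cmap :: "('m, 'e) chart \<Rightarrow> 'm \<Rightarrow> 'e" where "cmap \<equiv> snd"

definition cinv :: "('m, 'e) chart \<Rightarrow> 'e \<Rightarrow> 'm" where
  "cinv c = inv_into (cdom c) (cmap c)"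

definition is_chart :: "('m::topological_space, 'e::euclidean_space) chart \<Rightarrow> bool" where
  "is_chart c \<longleftrightarrow> open (cdom c) \<and> open (cmap c ` cdom c) \<and>
     homeomorphism (cdom c) (cmap c ` cdom c) (cmap c) (cinv c)"

definition smooth_atlas :: "('m::topological_space, 'e::euclidean_space) chart set \<Rightarrow> bool" where
  "smooth_atlas A \<longleftrightarrow> (\<forall>c\<in>A. is_chart c) \<and> (\<Union>c\<in>A. cdom c) = UNIV \<and>
     (\<forall>c\<in>A. \<forall>d\<in>A. smooth_on (cmap c ` (cdom c \<inter> cdom d)) (cmap d \<circ> cinv c))"

definition std_atlas :: "('e, 'e) chart set" where
  "std_atlas = {(UNIV, \<lambda>x. x)}"

definition prod_atlas :: "('m, 'e) chart set \<Rightarrow> ('m', 'e') chart set \<Rightarrow> ('m \<times> 'm', 'e \<times> 'e') chart set" where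
  "prod_atlas A A' = {(cdom c \<times> cdom d, map_prod (cmap c) (cmap d)) | c d. c \<in> A \<and> d \<in> A'}"

definition smooth_map :: "('m::topological_space, 'e::euclidean_space) chart set \<Rightarrow>
    ('m'::topological_space, 'e'::euclidean_space) chart set \<Rightarrow> 'm set \<Rightarrow> ('m \<Rightarrow> 'm') \<Rightarrow> bool" where
  "smooth_map A A' S F \<longleftrightarrow> continuous_on S F \<and>
     (\<forall>c\<in>A. \<forall>d\<in>A'. smooth_on (cmap c ` {p \<in> S \<inter> cdom c. F p \<in> cdom d}) (cmap d \<circ> F \<circ> cinv c))"

text \<open>A tangent vector at \<open>p\<close> is given by its components in each chart around \<open>p\<close>;
  \<open>tmap c d F p\<close> is the differential of \<open>F\<close> at \<open>p\<close> in the charts \<open>c\<close> and \<open>d\<close>.\<close>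

definition tmap :: "('m, 'e::real_normed_vector) chart \<Rightarrow> ('m', 'e'::real_normed_vector) chart \<Rightarrow>
    ('m \<Rightarrow> 'm') \<Rightarrow> 'm \<Rightarrow> 'e \<Rightarrow> 'e'" where
  "tmap c d F p = frechet_derivative (cmap d \<circ> F \<circ> cinv c) (at (cmap c p))"

abbreviation tchange :: "('m, 'e::real_normed_vector) chart \<Rightarrow> ('m, 'e) chart \<Rightarrow> 'm \<Rightarrow> 'e \<Rightarrow> 'e" where
  "tchange c d \<equiv> tmap c d (\<lambda>p. p)"

definition dfun :: "('m \<Rightarrow> real) \<Rightarrow> ('m, 'e::real_normed_vector) chart \<Rightarrow> 'm \<Rightarrow> 'e \<Rightarrow> real" where
  "dfun h c p = frechet_derivative (h \<circ> cinv c) (at (cmap c p))"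

text \<open>Tensor fields on a subset \<open>S\<close> are families of local representatives, indexed by the
  charts, that transform correctly.\<close>

definition one_form :: "('m::topological_space, 'e::euclidean_space) chart set \<Rightarrow> 'm set \<Rightarrow>
    (('m, 'e) chart \<Rightarrow> 'm \<Rightarrow> 'e \<Rightarrow> real) \<Rightarrow> bool" where
  "one_form A S \<theta> \<longleftrightarrow> (\<forall>c\<in>A.
     (\<forall>p \<in> S \<inter> cdom c. linear (\<theta> c p)) \<and>
     (\<forall>v. smooth_on (cmap c ` (S \<inter> cdom c)) (\<lambda>x. \<theta> c (cinv c x) v)) \<and>
     (\<forall>d\<in>A. \<forall>p \<in> S \<inter> cdom c \<inter> cdom d. \<forall>v. \<theta> c p v = \<theta> d p (tchange c d p v)))"

definition bilinear_field :: "('m::topological_space, 'e::euclidean_space) chart set \<Rightarrow> 'm set \<Rightarrow>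
    (('m, 'e) chart \<Rightarrow> 'm \<Rightarrow> 'e \<Rightarrow> 'e \<Rightarrow> real) \<Rightarrow> bool" where
  "bilinear_field A S g \<longleftrightarrow> (\<forall>c\<in>A.
     (\<forall>p \<in> S \<inter> cdom c. bilinear (g c p)) \<and>
     (\<forall>v w. smooth_on (cmap c ` (S \<inter> cdom c)) (\<lambda>x. g c (cinv c x) v w)) \<and>
     (\<forall>d\<in>A. \<forall>p \<in> S \<inter> cdom c \<inter> cdom d. \<forall>v w.
        g c p v w = g d p (tchange c d p v) (tchange c d p w)))"

definition endo_field :: "('m::topological_space, 'e::euclidean_space) chart set \<Rightarrow> 'm set \<Rightarrow>
    (('m, 'e) chart \<Rightarrow> 'm \<Rightarrow> 'e \<Rightarrow> 'e) \<Rightarrow> bool" where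
  "endo_field A S J \<longleftrightarrow> (\<forall>c\<in>A.
     (\<forall>p \<in> S \<inter> cdom c. linear (J c p)) \<and>
     (\<forall>v. smooth_on (cmap c ` (S \<inter> cdom c)) (\<lambda>x. J c (cinv c x) v)) \<and>
     (\<forall>d\<in>A. \<forall>p \<in> S \<inter> cdom c \<inter> cdom d. \<forall>v.
        tchange c d p (J c p v) = J d p (tchange c d p v)))"

text \<open>Exterior derivative of a 1-form, evaluated on coordinate vectors.\<close>

definition dform :: "(('m, 'e::real_normed_vector) chart \<Rightarrow> 'm \<Rightarrow> 'e \<Rightarrow> real) \<Rightarrow>
    ('m, 'e) chart \<Rightarrow> 'm \<Rightarrow> 'e \<Rightarrow> 'e \<Rightarrow> real" where
  "dform \<theta> c p v w = dfun (\<lambda>q. \<theta> c q w) c p v - dfun (\<lambda>q. \<theta> c q v) c p w"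

definition symplectic_form :: "('m::topological_space, 'e::euclidean_space) chart set \<Rightarrow>
    (('m, 'e) chart \<Rightarrow> 'm \<Rightarrow> 'e \<Rightarrow> 'e \<Rightarrow> real) \<Rightarrow> bool" where
  "symplectic_form A \<omega> \<longleftrightarrow> bilinear_field A UNIV \<omega> \<and>
     (\<forall>c\<in>A. \<forall>p\<in>cdom c.
        (\<forall>v. \<omega> c p v v = 0) \<and>
        (\<forall>v. v \<noteq> 0 \<longrightarrow> (\<exists>w. \<omega> c p v w \<noteq> 0)) \<and>
        (\<forall>u v w. dfun (\<lambda>q. \<omega> c q v w) c p u + dfun (\<lambda>q. \<omega> c q w u) c p v
                 + dfun (\<lambda>q. \<omega> c q u v) c p w = 0))"

definition compatible_acs :: "('m::topological_space, 'e::euclidean_space) chart set \<Rightarrow> 'm set \<Rightarrow>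
    (('m, 'e) chart \<Rightarrow> 'm \<Rightarrow> 'e \<Rightarrow> 'e \<Rightarrow> real) \<Rightarrow> (('m, 'e) chart \<Rightarrow> 'm \<Rightarrow> 'e \<Rightarrow> 'e) \<Rightarrow> bool" where
  "compatible_acs A S \<omega> J \<longleftrightarrow> endo_field A S J \<and>
     (\<forall>c\<in>A. \<forall>p \<in> S \<inter> cdom c.
        (\<forall>v. J c p (J c p v) = - v) \<and>
        (\<forall>v w. \<omega> c p (J c p v) (J c p w) = \<omega> c p v w) \<and>
        (\<forall>v. v \<noteq> 0 \<longrightarrow> \<omega> c p v (J c p v) > 0))"

definition pullback1 :: "('m', 'e'::real_normed_vector) chart set \<Rightarrow> ('m \<Rightarrow> 'm') \<Rightarrow>
    (('m', 'e') chart \<Rightarrow> 'm' \<Rightarrow> 'e' \<Rightarrow> real) \<Rightarrow> ('m, 'e::real_normed_vector) chart \<Rightarrow> 'm \<Rightarrow> 'e \<Rightarrow> real" where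
  "pullback1 A' F \<theta> c p v =
     (let d = (SOME d. d \<in> A' \<and> F p \<in> cdom d) in \<theta> d (F p) (tmap c d F p v))"

definition pullback2 :: "('m', 'e'::real_normed_vector) chart set \<Rightarrow> ('m \<Rightarrow> 'm') \<Rightarrow>
    (('m', 'e') chart \<Rightarrow> 'm' \<Rightarrow> 'e' \<Rightarrow> 'e' \<Rightarrow> real) \<Rightarrow>
    ('m, 'e::real_normed_vector) chart \<Rightarrow> 'm \<Rightarrow> 'e \<Rightarrow> 'e \<Rightarrow> real" where
  "pullback2 A' F \<omega> c p v w =
     (let d = (SOME d. d \<in> A' \<and> F p \<in> cdom d) in \<omega> d (F p) (tmap c d F p v) (tmap c d F p w))"


section \<open>Bounded geometry\<close>

definition riemannian_metric :: "('m::topological_space, 'e::euclidean_space) chart set \<Rightarrow> 'm set \<Rightarrow>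
    (('m, 'e) chart \<Rightarrow> 'm \<Rightarrow> 'e \<Rightarrow> 'e \<Rightarrow> real) \<Rightarrow> bool" where
  "riemannian_metric A S g \<longleftrightarrow> bilinear_field A S g \<and>
     (\<forall>c\<in>A. \<forall>p \<in> S \<inter> cdom c. (\<forall>v w. g c p v w = g c p w v) \<and> (\<forall>v. v \<noteq> 0 \<longrightarrow> g c p v v > 0))"

text \<open>\<open>christoffel g c p v w\<close> is the covariant derivative of the coordinate field \<open>w\<close> along \<open>v\<close>
  (Koszul formula), and \<open>curvature g c p u v w\<close> is \<open>R(u, v) w\<close>.\<close>

definition christoffel :: "(('m, 'e::real_normed_vector) chart \<Rightarrow> 'm \<Rightarrow> 'e \<Rightarrow> 'e \<Rightarrow> real) \<Rightarrow>
    ('m, 'e) chart \<Rightarrow> 'm \<Rightarrow> 'e \<Rightarrow> 'e \<Rightarrow> 'e" where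
  "christoffel g c p v w = (THE y. \<forall>z. 2 * g c p y z =
     dfun (\<lambda>q. g c q w z) c p v + dfun (\<lambda>q. g c q v z) c p w - dfun (\<lambda>q. g c q v w) c p z)"

definition curvature :: "(('m, 'e::real_normed_vector) chart \<Rightarrow> 'm \<Rightarrow> 'e \<Rightarrow> 'e \<Rightarrow> real) \<Rightarrow>
    ('m, 'e) chart \<Rightarrow> 'm \<Rightarrow> 'e \<Rightarrow> 'e \<Rightarrow> 'e \<Rightarrow> 'e" where
  "curvature g c p u v w =
     frechet_derivative (\<lambda>x. christoffel g c (cinv c x) v w) (at (cmap c p)) u
     - frechet_derivative (\<lambda>x. christoffel g c (cinv c x) u w) (at (cmap c p)) v
     + christoffel g c p u (christoffel g c p v w) - christoffel g c p v (christoffel g c p u w)"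

definition sectional_le :: "(('m, 'e::real_normed_vector) chart \<Rightarrow> 'm \<Rightarrow> 'e \<Rightarrow> 'e \<Rightarrow> real) \<Rightarrow>
    ('m, 'e) chart \<Rightarrow> 'm \<Rightarrow> real \<Rightarrow> bool" where
  "sectional_le g c p C \<longleftrightarrow> (\<forall>u v.
     g c p (curvature g c p u v v) u \<le> C * (g c p u u * g c p v v - (g c p u v)\<^sup>2))"

definition geodesic :: "('m::topological_space, 'e::euclidean_space) chart set \<Rightarrow> 'm set \<Rightarrow>
    (('m, 'e) chart \<Rightarrow> 'm \<Rightarrow> 'e \<Rightarrow> 'e \<Rightarrow> real) \<Rightarrow> (real \<Rightarrow> 'm) \<Rightarrow> bool" where
  "geodesic A S g \<gamma> \<longleftrightarrow> continuous_on {0..1} \<gamma> \<and> \<gamma> ` {0..1} \<subseteq> S \<and>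
     (\<forall>c\<in>A. \<exists>w. \<forall>t\<in>{0..1}. \<gamma> t \<in> cdom c \<longrightarrow>
        ((\<lambda>s. cmap c (\<gamma> s)) has_vector_derivative w t) (at t within {0..1}) \<and>
        (w has_vector_derivative - christoffel g c (\<gamma> t) (w t) (w t)) (at t within {0..1}))"

text \<open>The exponential map \<open>E\<close> at \<open>p\<close> is defined on the ball of radius \<open>r\<close> in the tangent
  space and is a diffeomorphism onto its image.\<close>

definition injectivity_radius_ge :: "('m::topological_space, 'e::euclidean_space) chart set \<Rightarrow> 'm set \<Rightarrow>
    (('m, 'e) chart \<Rightarrow> 'm \<Rightarrow> 'e \<Rightarrow> 'e \<Rightarrow> real) \<Rightarrow> ('m, 'e) chart \<Rightarrow> 'm \<Rightarrow> real \<Rightarrow> bool" where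
  "injectivity_radius_ge A S g c p r \<longleftrightarrow> (\<exists>E. let B = {v. g c p v v < r\<^sup>2} in
     (\<forall>v\<in>B. geodesic A S g (\<lambda>t. E (t *\<^sub>R v)) \<and>
        E 0 = p \<and> ((\<lambda>t. cmap c (E (t *\<^sub>R v))) has_vector_derivative v) (at 0 within {0..1})) \<and>
     inj_on E B \<and> smooth_map std_atlas A B E \<and>
     (\<forall>v\<in>B. \<forall>d\<in>A. E v \<in> cdom d \<longrightarrow> bij (frechet_derivative (cmap d \<circ> E) (at v))))"

definition speed :: "('m, 'e::real_normed_vector) chart set \<Rightarrow>
    (('m, 'e) chart \<Rightarrow> 'm \<Rightarrow> 'e \<Rightarrow> 'e \<Rightarrow> real) \<Rightarrow> (real \<Rightarrow> 'm) \<Rightarrow> real \<Rightarrow> real" where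
  "speed A g \<gamma> t =
     (let c = (SOME c. c \<in> A \<and> \<gamma> t \<in> cdom c);
          w = vector_derivative (\<lambda>s. cmap c (\<gamma> s)) (at t within {0..1})
      in sqrt (g c (\<gamma> t) w w))"

definition complete_metric :: "('m::topological_space, 'e::euclidean_space) chart set \<Rightarrow> 'm set \<Rightarrow>
    (('m, 'e) chart \<Rightarrow> 'm \<Rightarrow> 'e \<Rightarrow> 'e \<Rightarrow> real) \<Rightarrow> bool" where
  "complete_metric A S g \<longleftrightarrow> (\<forall>x :: nat \<Rightarrow> 'm. (\<forall>i. x i \<in> S) \<longrightarrow>
     (\<forall>\<epsilon>>0. \<exists>N. \<forall>i\<ge>N. \<forall>j\<ge>N. \<exists>\<gamma>. smooth_map std_atlas A {0..1} \<gamma> \<and> \<gamma> ` {0..1} \<subseteq> S \<and>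
        \<gamma> 0 = x i \<and> \<gamma> 1 = x j \<and> integral {0..1} (speed A g \<gamma>) < \<epsilon>) \<longrightarrow>
     (\<exists>l\<in>S. x \<longlonglongrightarrow> l))"

text \<open>For some complete metric and outside some compact set: \<open>J\<close> is uniformly tame, the
  sectional curvature is bounded above and the injectivity radius is bounded away from 0.\<close>

definition geometrically_bounded :: "('m::topological_space, 'e::euclidean_space) chart set \<Rightarrow> 'm set \<Rightarrow>
    (('m, 'e) chart \<Rightarrow> 'm \<Rightarrow> 'e \<Rightarrow> 'e \<Rightarrow> real) \<Rightarrow> (('m, 'e) chart \<Rightarrow> 'm \<Rightarrow> 'e \<Rightarrow> 'e) \<Rightarrow> bool" where
  "geometrically_bounded A S \<omega> J \<longleftrightarrow>
     (\<exists>g Q a b C r. riemannian_metric A S g \<and> complete_metric A S g \<and> compact Q \<and> Q \<subseteq> S \<and>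
        0 < a \<and> 0 < r \<and>
        (\<forall>c\<in>A. \<forall>p \<in> (interior S - Q) \<inter> cdom c.
           (\<forall>v. a * g c p v v \<le> \<omega> c p v (J c p v)) \<and>
           (\<forall>v w. \<bar>\<omega> c p v w\<bar> \<le> b * sqrt (g c p v v) * sqrt (g c p w w)) \<and>
           sectional_le g c p C \<and> injectivity_radius_ge A S g c p r))"


section \<open>Symplectic \<open>\<complex>\<^sup>*\<close>-manifolds over a convex base\<close>

text \<open>The circle is \<open>\<real>/\<int>\<close>, acting through \<open>t \<mapsto> exp (2 \<pi> i t)\<close>; \<open>circle_field \<phi> c p\<close> is its
  generating vector field in the chart \<open>c\<close>.\<close>

definition circle :: "real \<Rightarrow> complex" where
  "circle t = cis (2 * pi * t)"

definition circle_field :: "(complex \<Rightarrow> 'y \<Rightarrow> 'y) \<Rightarrow> ('y, 'e::real_normed_vector) chart \<Rightarrow> 'y \<Rightarrow> 'e" where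
  "circle_field \<phi> c p = vector_derivative (\<lambda>t. cmap c (\<phi> (circle t) p)) (at 0)"

text \<open>\<open>\<complex>\<^sup>n\<close> is the model of \<open>\<real>\<^sup>2\<^sup>n\<close>, with \<open>n = CARD('n)\<close>; its complex structure is not used here.\<close>

locale symplectic_Cstar_manifold =
  fixes A :: "('y::{second_countable_topology, t2_space}, complex ^ 'n::finite) chart set"
    and \<omega> :: "('y, complex ^ 'n) chart \<Rightarrow> 'y \<Rightarrow> complex ^ 'n \<Rightarrow> complex ^ 'n \<Rightarrow> real"
    and I :: "('y, complex ^ 'n) chart \<Rightarrow> 'y \<Rightarrow> complex ^ 'n \<Rightarrow> complex ^ 'n"
    and \<phi> :: "complex \<Rightarrow> 'y \<Rightarrow> 'y"
    and H :: "'y \<Rightarrow> real"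
  assumes atlas: "smooth_atlas A"
    and connected: "connected (UNIV :: 'y set)"
    and symplectic: "symplectic_form A \<omega>"
    and compatible: "compatible_acs A UNIV \<omega> I"
    and act_one: "\<And>p. \<phi> 1 p = p"
    and act_mult: "\<And>z w p. z \<noteq> 0 \<Longrightarrow> w \<noteq> 0 \<Longrightarrow> \<phi> (z * w) p = \<phi> z (\<phi> w p)"
    and act_smooth: "smooth_map (prod_atlas std_atlas A) A ((- {0}) \<times> UNIV) (\<lambda>(z, p). \<phi> z p)"
    and act_holomorphic: "\<And>C c d z p \<zeta> v. C = (UNIV \<times> cdom c, map_prod (\<lambda>z. z) (cmap c)) \<Longrightarrow>
        c \<in> A \<Longrightarrow> d \<in> A \<Longrightarrow> z \<noteq> 0 \<Longrightarrow> p \<in> cdom c \<Longrightarrow> \<phi> z p \<in> cdom d \<Longrightarrow>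
        tmap C d (\<lambda>(z, p). \<phi> z p) (z, p) (\<i> * \<zeta>, I c p v)
          = I d (\<phi> z p) (tmap C d (\<lambda>(z, p). \<phi> z p) (z, p) (\<zeta>, v))"
    and moment_smooth: "smooth_map A std_atlas UNIV H"
    and moment_map: "\<And>c p v. c \<in> A \<Longrightarrow> p \<in> cdom c \<Longrightarrow> \<omega> c p v (circle_field \<phi> c p) = dfun H c p v"

definition contact_form :: "('s::topological_space, 'f::euclidean_space) chart set \<Rightarrow>
    (('s, 'f) chart \<Rightarrow> 's \<Rightarrow> 'f \<Rightarrow> real) \<Rightarrow> bool" where
  "contact_form A \<alpha> \<longleftrightarrow> one_form A UNIV \<alpha> \<and>
     (\<forall>c\<in>A. \<forall>p\<in>cdom c. (\<exists>v. \<alpha> c p v \<noteq> 0) \<and>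
        (\<forall>v. \<alpha> c p v = 0 \<and> v \<noteq> 0 \<longrightarrow> (\<exists>w. \<alpha> c p w = 0 \<and> dform \<alpha> c p v w \<noteq> 0)))"

definition reeb_invariant :: "('s, 'f::real_normed_vector) chart set \<Rightarrow>
    (('s, 'f) chart \<Rightarrow> 's \<Rightarrow> 'f \<Rightarrow> real) \<Rightarrow> ('s \<Rightarrow> real) \<Rightarrow> bool" where
  "reeb_invariant A \<alpha> f \<longleftrightarrow> (\<forall>c\<in>A. \<forall>p\<in>cdom c. \<forall>v.
     \<alpha> c p v = 1 \<and> (\<forall>w. dform \<alpha> c p v w = 0) \<longrightarrow> dfun f c p v = 0)"

text \<open>The form \<open>d(R \<alpha>)\<close> on \<open>\<Sigma> \<times> \<real>\<close>, where \<open>R\<close> is the second coordinate.\<close>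

definition liouville :: "('s, 'f::real_normed_vector) chart set \<Rightarrow> (('s, 'f) chart \<Rightarrow> 's \<Rightarrow> 'f \<Rightarrow> real) \<Rightarrow>
    ('s \<times> real, 'f \<times> real) chart \<Rightarrow> 's \<times> real \<Rightarrow> 'f \<times> real \<Rightarrow> real" where
  "liouville A \<alpha> c q v = snd q * pullback1 A fst \<alpha> c q v"

definition compact_subdomain :: "('m::topological_space, 'e::euclidean_space) chart set \<Rightarrow> 'm set \<Rightarrow> bool" where
  "compact_subdomain A K \<longleftrightarrow> compact K \<and>
     (\<forall>p \<in> frontier K. \<exists>c b. smooth_atlas (insert c A) \<and> p \<in> cdom c \<and> b \<noteq> 0 \<and> cmap c p \<bullet> b = 0 \<and>
        K \<inter> cdom c = {q \<in> cdom c. cmap c q \<bullet> b \<le> 0})"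

locale over_convex_base = symplectic_Cstar_manifold A \<omega> I \<phi> H
  for A :: "('y::{second_countable_topology, t2_space}, complex ^ 'n::finite) chart set"
    and \<omega> I \<phi> H +
  fixes K :: "'y set"
    and \<Sigma> :: "('s::{second_countable_topology, t2_space}, 'f::euclidean_space) chart set"
    and \<alpha> :: "('s, 'f) chart \<Rightarrow> 's \<Rightarrow> 'f \<Rightarrow> real"
    and R0 :: real
    and I\<^sub>B :: "('s \<times> real, 'f \<times> real) chart \<Rightarrow> 's \<times> real \<Rightarrow> 'f \<times> real \<Rightarrow> 'f \<times> real"
    and \<Psi> :: "'y \<Rightarrow> 's \<times> real"
    and f :: "'s \<Rightarrow> real"
  assumes noncompact: "\<not> compact (UNIV :: 'y set)"
    and moment_proper: "\<And>L. compact L \<Longrightarrow> compact (H -` L)"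
    and subdomain: "compact_subdomain A K"
    and contact_atlas: "smooth_atlas \<Sigma>"
    and contact_closed: "compact (UNIV :: 's set)"
    and contact: "contact_form \<Sigma> \<alpha>"
    and R0_pos: "0 < R0"
    and base_compatible:
      "compatible_acs (prod_atlas \<Sigma> std_atlas) (UNIV \<times> {R0..}) (dform (liouville \<Sigma> \<alpha>)) I\<^sub>B"
    and base_contact_type: "\<And>c q v. c \<in> prod_atlas \<Sigma> std_atlas \<Longrightarrow> q \<in> UNIV \<times> {R0..} \<Longrightarrow>
      q \<in> cdom c \<Longrightarrow> dfun snd c q v = liouville \<Sigma> \<alpha> c q (I\<^sub>B c q v)"
    and base_bounded:
      "geometrically_bounded (prod_atlas \<Sigma> std_atlas) (UNIV \<times> {R0..}) (dform (liouville \<Sigma> \<alpha>)) I\<^sub>B"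
    and f_smooth: "smooth_map \<Sigma> std_atlas UNIV f"
    and f_pos: "\<And>s. 0 < f s"
    and f_reeb: "reeb_invariant \<Sigma> \<alpha> f"
    and Psi_smooth: "smooth_map A (prod_atlas \<Sigma> std_atlas) (- interior K) \<Psi>"
    and Psi_range: "\<Psi> ` (- interior K) \<subseteq> UNIV \<times> {R0..}"
    and Psi_proper: "\<And>L. compact L \<Longrightarrow> L \<subseteq> UNIV \<times> {R0..} \<Longrightarrow> compact (\<Psi> -` L \<inter> - interior K)"
    and Psi_holomorphic: "\<And>c d p v. c \<in> A \<Longrightarrow> d \<in> prod_atlas \<Sigma> std_atlas \<Longrightarrow>
      p \<in> interior (- interior K) \<Longrightarrow> p \<in> cdom c \<Longrightarrow> \<Psi> p \<in> cdom d \<Longrightarrow>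
      tmap c d \<Psi> p (I c p v) = I\<^sub>B d (\<Psi> p) (tmap c d \<Psi> p v)"
    \<comment> \<open>\<open>\<Psi>\<^sub>*\<close> sends the circle field to \<open>X\<^sub>f\<^sub>R\<close>, characterised by \<open>d(R\<alpha>)(\<cdot>, X\<^sub>f\<^sub>R) = d(fR)\<close>\<close>
    and Psi_reeb: "\<And>c d p w. c \<in> A \<Longrightarrow> d \<in> prod_atlas \<Sigma> std_atlas \<Longrightarrow>
      p \<in> interior (- interior K) \<Longrightarrow> p \<in> cdom c \<Longrightarrow> \<Psi> p \<in> cdom d \<Longrightarrow>
      dform (liouville \<Sigma> \<alpha>) d (\<Psi> p) w (tmap c d \<Psi> p (circle_field \<phi> c p))
        = dfun (\<lambda>(s, R). f s * R) d (\<Psi> p) w"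


section \<open>Weak monotonicity\<close>

text \<open>Classes in \<open>\<pi>\<^sub>2\<close> are represented by smooth maps from the plane that are constant outside
  the open unit disc.\<close>

definition smooth_sphere :: "('m::topological_space, 'e::euclidean_space) chart set \<Rightarrow> (complex \<Rightarrow> 'm) \<Rightarrow> bool" where
  "smooth_sphere A u \<longleftrightarrow> smooth_map std_atlas A UNIV u \<and> (\<forall>z. 1 \<le> norm z \<longrightarrow> u z = u 1)"

definition area :: "('m, 'e::real_normed_vector) chart set \<Rightarrow> (('m, 'e) chart \<Rightarrow> 'm \<Rightarrow> 'e \<Rightarrow> 'e \<Rightarrow> real) \<Rightarrow>
    (complex \<Rightarrow> 'm) \<Rightarrow> real" where
  "area A \<omega> u = integral (cball 0 1) (\<lambda>z. pullback2 A u \<omega> (UNIV, \<lambda>z. z) z 1 \<i>)"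

text \<open>A complex frame, over the unit disc, of the pullback of the tangent bundle by \<open>u\<close>.\<close>

definition complex_frame :: "('m, complex ^ 'n) chart set \<Rightarrow>
    (('m, complex ^ 'n) chart \<Rightarrow> 'm \<Rightarrow> complex ^ 'n \<Rightarrow> complex ^ 'n) \<Rightarrow> (complex \<Rightarrow> 'm) \<Rightarrow>
    (('m, complex ^ 'n) chart \<Rightarrow> complex \<Rightarrow> complex ^ 'n \<Rightarrow> complex ^ 'n) \<Rightarrow> bool" where
  "complex_frame A I u \<Phi> \<longleftrightarrow> (\<forall>c\<in>A.
     (\<forall>z \<in> cball 0 1. u z \<in> cdom c \<longrightarrow>
        linear (\<Phi> c z) \<and> bij (\<Phi> c z) \<and> (\<forall>v. \<Phi> c z (\<i> *s v) = I c (u z) (\<Phi> c z v)) \<and>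
        (\<forall>d\<in>A. u z \<in> cdom d \<longrightarrow> (\<forall>v. \<Phi> d z v = tchange c d (u z) (\<Phi> c z v)))) \<and>
     (\<forall>v. continuous_on {z \<in> cball 0 1. u z \<in> cdom c} (\<lambda>z. \<Phi> c z v)))"

text \<open>Over the complement of the disc the pulled back bundle is trivialised by \<open>\<Phi> 1\<close>. On the
  boundary circle the frame is \<open>M(z)\<close> times this trivialisation, and the first Chern number is
  minus the winding number of \<open>det M\<close>; with this sign it is 2 for the tangent bundle of the
  Riemann sphere.\<close>

definition chern_number :: "('m, complex ^ 'n::finite) chart set \<Rightarrow>
    (('m, complex ^ 'n) chart \<Rightarrow> 'm \<Rightarrow> complex ^ 'n \<Rightarrow> complex ^ 'n) \<Rightarrow> (complex \<Rightarrow> 'm) \<Rightarrow> int" where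
  "chern_number A I u = (THE k. \<exists>\<Phi>. complex_frame A I u \<Phi> \<and> (\<exists>c\<in>A. u 1 \<in> cdom c \<and>
     winding_number (\<lambda>t. det (matrix (inv_into UNIV (\<Phi> c 1) \<circ> \<Phi> c (circle t)))) 0 = - of_int k))"

definition weakly_monotone :: "('m::topological_space, complex ^ 'n::finite) chart set \<Rightarrow>
    (('m, complex ^ 'n) chart \<Rightarrow> 'm \<Rightarrow> complex ^ 'n \<Rightarrow> complex ^ 'n \<Rightarrow> real) \<Rightarrow>
    (('m, complex ^ 'n) chart \<Rightarrow> 'm \<Rightarrow> complex ^ 'n \<Rightarrow> complex ^ 'n) \<Rightarrow> bool" where
  "weakly_monotone A \<omega> I \<longleftrightarrow>
     (\<forall>u. smooth_sphere A u \<longrightarrow> chern_number A I u = 0) \<or>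
     (\<forall>u. smooth_sphere A u \<longrightarrow> area A \<omega> u = 0) \<or>
     (\<exists>k>0. \<forall>u. smooth_sphere A u \<longrightarrow> of_int (chern_number A I u) = k * area A \<omega> u) \<or>
     (\<forall>u. smooth_sphere A u \<longrightarrow> 0 < chern_number A I u \<longrightarrow> int CARD('n) - 2 \<le> chern_number A I u)"


section \<open>Floer cohomology and the filtration\<close>

definition orbit_period :: "(complex \<Rightarrow> 'y \<Rightarrow> 'y) \<Rightarrow> real \<Rightarrow> bool" where
  "orbit_period \<phi> T \<longleftrightarrow> 0 < T \<and> (\<exists>p. \<phi> (circle T) p = p \<and> (\<exists>t. \<phi> (circle t) p \<noteq> p))"

definition generic_slope :: "(complex \<Rightarrow> 'y \<Rightarrow> 'y) \<Rightarrow> real \<Rightarrow> bool" where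
  "generic_slope \<phi> \<kappa> \<longleftrightarrow> 0 < \<kappa> \<and> \<not> orbit_period \<phi> \<kappa>"

definition small_slope :: "(complex \<Rightarrow> 'y \<Rightarrow> 'y) \<Rightarrow> real \<Rightarrow> bool" where
  "small_slope \<phi> \<delta> \<longleftrightarrow> 0 < \<delta> \<and> (\<forall>T. orbit_period \<phi> T \<longrightarrow> \<delta> < T)"

definition quantum_product :: "(('y::topological_space, 'b::field) qh \<Rightarrow> ('y, 'b) qh \<Rightarrow> ('y, 'b) qh) \<Rightarrow> bool" where
  "quantum_product m \<longleftrightarrow>
     (\<forall>x. Vector_Spaces.linear qh_scale qh_scale (m x)) \<and>
     (\<forall>y. Vector_Spaces.linear qh_scale qh_scale (\<lambda>x. m x y)) \<and>
     (\<forall>x y z. m (m x y) z = m x (m y z)) \<and>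
     (\<forall>x. m (const_qh unit_coh) x = x \<and> m x (const_qh unit_coh) = x) \<and>
     (\<forall>i j. \<forall>x \<in> qh_parity i. \<forall>y \<in> qh_parity j. m x y \<in> qh_parity (i + j) \<and>
        m y x = qh_scale ((- 1) ^ (i * j)) (m x y)) \<and>
     \<comment> \<open>deformation of the cup product by strictly positive powers of \<open>T\<close>\<close>
     (\<forall>h h'. qcoeff (m (const_qh h) (const_qh h')) 0 = h \<smile> h' \<and>
        (\<forall>a<0. qcoeff (m (const_qh h) (const_qh h')) a = 0))"

text \<open>
  The Floer groups of the Hamiltonians of slope \<open>\<kappa>\<close> at infinity, given with their standard
  structure. They are not constructed from moduli spaces of Floer trajectories: the locale
  collects the structural theorems of Floer theory. All groups are realised as subspaces \<open>HF \<kappa>\<close> of one ambient space; \<open>HF_gr \<kappa> i\<close> is the part of parity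
  \<open>i mod 2\<close>, \<open>cont \<kappa> \<mu>\<close> is the continuation map, \<open>PSS \<delta>\<close> is the isomorphism for small slopes,
  and \<open>act \<kappa>\<close> is the quantum cap action making \<open>HF \<kappa>\<close> a module over quantum cohomology.
\<close>

locale floer_theory =
  fixes \<phi> :: "complex \<Rightarrow> 'y::topological_space \<Rightarrow> 'y"
    and qmult :: "('y, 'b::field) qh \<Rightarrow> ('y, 'b) qh \<Rightarrow> ('y, 'b) qh"  (infixl "\<star>" 70)
    and scale :: "'b novikov \<Rightarrow> 'v::ab_group_add \<Rightarrow> 'v"
    and HF :: "real \<Rightarrow> 'v set"
    and HF_gr :: "real \<Rightarrow> nat \<Rightarrow> 'v set"
    and PSS :: "real \<Rightarrow> ('y, 'b) qh \<Rightarrow> 'v"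
    and cont :: "real \<Rightarrow> real \<Rightarrow> 'v \<Rightarrow> 'v"
    and act :: "real \<Rightarrow> ('y, 'b) qh \<Rightarrow> 'v \<Rightarrow> 'v"
  assumes quantum: "quantum_product qmult"
    and vector_space: "Vector_Spaces.vector_space scale"
    and HF_subspace: "\<And>\<kappa>. generic_slope \<phi> \<kappa> \<Longrightarrow> Modules.module.subspace scale (HF \<kappa>)"
    and HF_gr_subspace: "\<And>\<kappa> i. generic_slope \<phi> \<kappa> \<Longrightarrow> Modules.module.subspace scale (HF_gr \<kappa> i)"
    and HF_gr_mod: "\<And>\<kappa> i. generic_slope \<phi> \<kappa> \<Longrightarrow> HF_gr \<kappa> (i mod 2) = HF_gr \<kappa> i"
    and HF_gr_sum: "\<And>\<kappa>. generic_slope \<phi> \<kappa> \<Longrightarrow> HF \<kappa> = {v + w | v w. v \<in> HF_gr \<kappa> 0 \<and> w \<in> HF_gr \<kappa> 1}"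
    and HF_gr_direct: "\<And>\<kappa>. generic_slope \<phi> \<kappa> \<Longrightarrow> HF_gr \<kappa> 0 \<inter> HF_gr \<kappa> 1 = {0}"
    and PSS_linear: "\<And>\<delta>. small_slope \<phi> \<delta> \<Longrightarrow> Vector_Spaces.linear qh_scale scale (PSS \<delta>)"
    and PSS_iso: "\<And>\<delta>. small_slope \<phi> \<delta> \<Longrightarrow> bij_betw (PSS \<delta>) UNIV (HF \<delta>)"
    and PSS_degree: "\<And>\<delta> i. small_slope \<phi> \<delta> \<Longrightarrow> PSS \<delta> ` qh_parity i \<subseteq> HF_gr \<delta> i"
    and PSS_mult: "\<And>\<delta> x y. small_slope \<phi> \<delta> \<Longrightarrow> PSS \<delta> (x \<star> y) = act \<delta> x (PSS \<delta> y)"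
    and PSS_cont: "\<And>\<delta> \<delta>' x. small_slope \<phi> \<delta> \<Longrightarrow> small_slope \<phi> \<delta>' \<Longrightarrow> \<delta> \<le> \<delta>' \<Longrightarrow>
        cont \<delta> \<delta>' (PSS \<delta> x) = PSS \<delta>' x"
    and cont_add: "\<And>\<kappa> \<mu> v w. generic_slope \<phi> \<kappa> \<Longrightarrow> generic_slope \<phi> \<mu> \<Longrightarrow> \<kappa> \<le> \<mu> \<Longrightarrow>
        v \<in> HF \<kappa> \<Longrightarrow> w \<in> HF \<kappa> \<Longrightarrow> cont \<kappa> \<mu> (v + w) = cont \<kappa> \<mu> v + cont \<kappa> \<mu> w"
    and cont_scale: "\<And>\<kappa> \<mu> v k. generic_slope \<phi> \<kappa> \<Longrightarrow> generic_slope \<phi> \<mu> \<Longrightarrow> \<kappa> \<le> \<mu> \<Longrightarrow>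
        v \<in> HF \<kappa> \<Longrightarrow> cont \<kappa> \<mu> (scale k v) = scale k (cont \<kappa> \<mu> v)"
    and cont_degree: "\<And>\<kappa> \<mu> i. generic_slope \<phi> \<kappa> \<Longrightarrow> generic_slope \<phi> \<mu> \<Longrightarrow> \<kappa> \<le> \<mu> \<Longrightarrow>
        cont \<kappa> \<mu> ` HF_gr \<kappa> i \<subseteq> HF_gr \<mu> i"
    and cont_id: "\<And>\<kappa> v. generic_slope \<phi> \<kappa> \<Longrightarrow> v \<in> HF \<kappa> \<Longrightarrow> cont \<kappa> \<kappa> v = v"
    and cont_comp: "\<And>\<kappa> \<mu> \<nu> v. generic_slope \<phi> \<kappa> \<Longrightarrow> generic_slope \<phi> \<mu> \<Longrightarrow> generic_slope \<phi> \<nu> \<Longrightarrow>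
        \<kappa> \<le> \<mu> \<Longrightarrow> \<mu> \<le> \<nu> \<Longrightarrow> v \<in> HF \<kappa> \<Longrightarrow> cont \<mu> \<nu> (cont \<kappa> \<mu> v) = cont \<kappa> \<nu> v"
    and act_add: "\<And>\<kappa> x v w. generic_slope \<phi> \<kappa> \<Longrightarrow> v \<in> HF \<kappa> \<Longrightarrow> w \<in> HF \<kappa> \<Longrightarrow>
        act \<kappa> x (v + w) = act \<kappa> x v + act \<kappa> x w"
    and act_scale: "\<And>\<kappa> x v k. generic_slope \<phi> \<kappa> \<Longrightarrow> v \<in> HF \<kappa> \<Longrightarrow>
        act \<kappa> x (scale k v) = scale k (act \<kappa> x v)"
    and act_linear: "\<And>\<kappa> v. generic_slope \<phi> \<kappa> \<Longrightarrow> v \<in> HF \<kappa> \<Longrightarrow>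
        Vector_Spaces.linear qh_scale scale (\<lambda>x. act \<kappa> x v)"
    and act_degree: "\<And>\<kappa> i j x v. generic_slope \<phi> \<kappa> \<Longrightarrow> x \<in> qh_parity i \<Longrightarrow> v \<in> HF_gr \<kappa> j \<Longrightarrow>
        act \<kappa> x v \<in> HF_gr \<kappa> (i + j)"
    and act_unit: "\<And>\<kappa> v. generic_slope \<phi> \<kappa> \<Longrightarrow> v \<in> HF \<kappa> \<Longrightarrow> act \<kappa> (const_qh unit_coh) v = v"
    and act_mult: "\<And>\<kappa> x y v. generic_slope \<phi> \<kappa> \<Longrightarrow> v \<in> HF \<kappa> \<Longrightarrow>
        act \<kappa> (x \<star> y) v = act \<kappa> x (act \<kappa> y v)"
    and cont_act: "\<And>\<kappa> \<mu> x v. generic_slope \<phi> \<kappa> \<Longrightarrow> generic_slope \<phi> \<mu> \<Longrightarrow> \<kappa> \<le> \<mu> \<Longrightarrow> v \<in> HF \<kappa> \<Longrightarrow>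
        cont \<kappa> \<mu> (act \<kappa> x v) = act \<mu> x (cont \<kappa> \<mu> v)"

text \<open>PSS followed by the continuation map to \<open>HF \<kappa>\<close>. If \<open>\<kappa> < \<delta>\<close> then \<open>\<kappa>\<close> is itself small and
  replaces \<open>\<delta>\<close>, as continuation maps increase the slope.\<close>

definition c_map :: "(real \<Rightarrow> ('y::topological_space, 'b::field) qh \<Rightarrow> 'v) \<Rightarrow> (real \<Rightarrow> real \<Rightarrow> 'v \<Rightarrow> 'v) \<Rightarrow>
    real \<Rightarrow> real \<Rightarrow> ('y, 'b) qh \<Rightarrow> 'v" where
  "c_map PSS cont \<delta> \<kappa> = cont (min \<delta> \<kappa>) \<kappa> \<circ> PSS (min \<delta> \<kappa>)"

definition floer_filtration :: "(complex \<Rightarrow> 'y \<Rightarrow> 'y) \<Rightarrow>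
    (real \<Rightarrow> ('y::topological_space, 'b::field) qh \<Rightarrow> 'v::zero) \<Rightarrow> (real \<Rightarrow> real \<Rightarrow> 'v \<Rightarrow> 'v) \<Rightarrow>
    real \<Rightarrow> ereal \<Rightarrow> ('y, 'b) qh set" where
  "floer_filtration \<phi> PSS cont \<delta> p =
     (if p = \<infinity> then UNIV
      else \<Inter>\<kappa> \<in> {\<kappa>. generic_slope \<phi> \<kappa> \<and> p \<le> ereal \<kappa>}. {x. c_map PSS cont \<delta> \<kappa> x = 0})"

definition specialised_filtration :: "(complex \<Rightarrow> 'y \<Rightarrow> 'y) \<Rightarrow>
    (real \<Rightarrow> ('y::topological_space, 'b::field) qh \<Rightarrow> 'v::zero) \<Rightarrow> (real \<Rightarrow> real \<Rightarrow> 'v \<Rightarrow> 'v) \<Rightarrow>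
    real \<Rightarrow> ereal \<Rightarrow> ('y, 'b) coh set" where
  "specialised_filtration \<phi> PSS cont \<delta> p = ini ` floer_filtration \<phi> PSS cont \<delta> p"

end

theory Submission
  imports Defs
begin

text \<open>
  On a \<open>K\<close>-subspace \<open>S\<close> of \<open>QH\<close>, multiplication by powers of \<open>T\<close> identifies \<open>ini(S)\<close> with the
  image under \<open>T \<mapsto> 0\<close> of the elements of \<open>S\<close> without negative exponents. Since the quantum product
  deforms the cup product by positive powers of \<open>T\<close>, this reduction is multiplicative, so quantum
  ideals are sent to cup product ideals. The kernels of the maps \<open>c\<close> are left ideals by linearity of the
  continuation maps over the quantum cap action, and right ideals because they are graded by parity
  and the product is graded commutative. For the ranks, lifts of independent initial parts are
  independent (look at the lowest exponent of a relation); conversely, Gaussian elimination with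
  pivots of least valuation turns \<open>n\<close> independent elements of \<open>S\<close> into \<open>n\<close> elements of \<open>S\<close> that
  reduce to independent classes. This needs neither completeness nor finite dimension.
\<close>

section \<open>Rank and independent families\<close>

context Vector_Spaces.vector_space
begin

text \<open>Finite and infinite rank are treated alike this way, so ranks over different fields can
  be compared by transporting finite independent sets. If no finite set spans, a basis is infinite
  and has finite subsets of every size; otherwise the exchange bound applies.\<close>

lemma enat_le_rank_iff:
  "enat n \<le> rank S \<longleftrightarrow> (\<exists>B\<subseteq>S. finite B \<and> independent B \<and> card B = n)"
proof -
  obtain B where B: "B \<subseteq> S" "independent B" "S \<subseteq> span B" "card B = dim S"
    by (rule basis_exists)
  have span_B: "span B = span S"
    using B by (metis span_eq span_superset subset_trans)
  show ?thesis
  proof (cases "\<exists>C. finite C \<and> span C = span S")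
    case True
    then obtain C where C: "finite C" "span C = span S" by blast
    have bound: "finite D \<and> card D \<le> card B" if D: "D \<subseteq> S" "independent D" for D
    proof -
      have "finite B" using independent_span_bound[OF C(1) B(2)] span_superset[of B] C span_B by auto
      then show ?thesis using independent_span_bound[OF _ D(2)] D(1) B(3) by blast
    qed
    have rank: "rank S = enat (card B)" using True B(4) by (simp add: rank_def)
    show ?thesis
    proof
      assume "enat n \<le> rank S"
      then obtain D where "D \<subseteq> B" "card D = n" "finite D"
        using rank by (auto elim: obtain_subset_with_card_n)
      then show "\<exists>B\<subseteq>S. finite B \<and> independent B \<and> card B = n"
        using independent_mono[OF B(2)] B(1) by blast
    next
      assume "\<exists>B\<subseteq>S. finite B \<and> independent B \<and> card B = n"
      then show "enat n \<le> rank S" using bound rank by auto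
    qed
  next
    case False
    then have "infinite B" using span_B by blast
    then obtain D where "D \<subseteq> B" "finite D" "card D = n"
      using infinite_arbitrarily_large by blast
    moreover from this have "independent D" using independent_mono[OF B(2)] by blast
    moreover have "rank S = \<infinity>" using False by (simp add: rank_def)
    ultimately show ?thesis using B by auto
  qed
qed

text \<open>The coefficients are indexed by \<open>P\<close>, so a coincidence
  \<open>f p = f q\<close> is itself a forbidden relation, with coefficients 1 and -1. Injectivity
  preserves the cardinality of the family.\<close>

lemma independent_image:
  assumes "finite P"
    and zero: "\<And>c p. (\<Sum>p\<in>P. scale (c p) (f p)) = 0 \<Longrightarrow> p \<in> P \<Longrightarrow> c p = 0"
  shows "inj_on f P" and "independent (f ` P)"
proof -
  show inj: "inj_on f P"
  proof (rule inj_onI, rule ccontr)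
    fix p q assume pq: "p \<in> P" "q \<in> P" "f p = f q" "p \<noteq> q"
    define c where "c r = (if r = p then 1 else if r = q then - 1 else 0 :: 'a)" for r
    have "(\<Sum>r\<in>P. scale (c r) (f r)) = (\<Sum>r\<in>{p, q}. scale (c r) (f r))"
      by (rule sum.mono_neutral_right) (use assms(1) pq in \<open>auto simp: c_def\<close>)
    also have "\<dots> = 0" using pq by (simp add: c_def)
    finally have "c p = 0" using zero pq(1) by blast
    then show False by (simp add: c_def)
  qed
  show "independent (f ` P)"
  proof (rule independent_if_scalars_zero)
    fix g v assume sum: "(\<Sum>v\<in>f ` P. scale (g v) v) = 0" and "v \<in> f ` P"
    then obtain p where p: "v = f p" "p \<in> P" by blast
    have "(\<Sum>p\<in>P. scale (g (f p)) (f p)) = 0" using sum by (simp add: sum.reindex[OF inj])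
    then show "g v = 0" using zero[of "\<lambda>p. g (f p)" p] p by simp
  qed (use assms(1) in simp)
qed

end

section \<open>Lowest terms of Novikov series\<close>

text \<open>Below any exponent \<open>a\<close> of the support only finitely many exponents remain,
  and their minimum is the least one overall.\<close>

lemma left_finite_least_exponent:
  assumes "left_finite x" "x a \<noteq> 0"
  obtains a0 where "x a0 \<noteq> 0" "\<And>b. b < a0 \<Longrightarrow> x b = 0"
proof -
  let ?F = "{b. x b \<noteq> 0 \<and> b \<le> a}"
  have fin: "finite ?F" using assms(1) by (simp add: left_finite_def)
  have ne: "?F \<noteq> {}" using assms(2) by auto
  have "x (Min ?F) \<noteq> 0" "Min ?F \<le> a" using Min_in[OF fin ne] by auto
  moreover have "x b = 0" if "b < Min ?F" for b
    using Min_le[OF fin, of b] that calculation(2) by force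
  ultimately show ?thesis using that by blast
qed

text \<open>Exponents add, and only the pair \<open>c\<close>, \<open>d\<close> can contribute at
  \<open>c + d\<close>. Both are just lower bounds, so with \<open>c = d = 0\<close> the constant
  term is multiplicative on series without negative exponents.\<close>

lemma (in Modules.module) conv_lowest:
  assumes "\<And>b. b < c \<Longrightarrow> k b = 0" and "\<And>b. b < d \<Longrightarrow> x b = 0"
  shows "a < c + d \<Longrightarrow> conv scale k x a = 0"
    and "conv scale k x (c + d) = scale (k c) (x d)"
proof -
  show "conv scale k x a = 0" if "a < c + d"
  proof (rule ccontr)
    assume "conv scale k x a \<noteq> 0"
    then obtain b where "k b \<noteq> 0" "x (a - b) \<noteq> 0" by (rule conv_neq0)
    then have "c \<le> b" "d \<le> a - b" using assms by (meson not_le)+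
    then show False using that by simp
  qed
  have "conv scale k x (c + d) = (\<Sum>b\<in>{c}. scale (k b) (x (c + d - b)))"
  proof (rule conv_eq)
    fix b assume "k b \<noteq> 0" "x (c + d - b) \<noteq> 0"
    then have "c \<le> b" "d \<le> c + d - b" using assms by (meson not_le)+
    then show "b \<in> {c}" by simp
  qed simp
  then show "conv scale k x (c + d) = scale (k c) (x d)" by simp
qed

lemma left_finite_ncoeff: "left_finite (ncoeff k)"
  using ncoeff[of k] by simp

lemma left_finite_qcoeff: "left_finite (qcoeff x)"
  using qcoeff[of x] by simp

lemma qh_eqI: "(\<And>a. qcoeff x a = qcoeff y a) \<Longrightarrow> x = y"
  by (simp add: qcoeff_inject[symmetric] fun_eq_iff)

lemma qcoeff_minus: "qcoeff (x - y) a = qcoeff x a - qcoeff y a"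
  by (simp only: diff_conv_add_uminus plus_qh.rep_eq uminus_qh.rep_eq)

lemma qcoeff_sum: "qcoeff (sum f F) a = (\<Sum>i\<in>F. qcoeff (f i) a)"
  by (induction F rule: infinite_finite_induct) (auto simp: zero_qh.rep_eq plus_qh.rep_eq)

lemma qcoeff_monom_scale: "qcoeff (qh_scale (nmonom c r) x) a = coh_scale r (qcoeff x (a - c))"
  by (simp add: qh_scale.rep_eq nmonom.rep_eq coh.conv_single_left)

lemma nonzero_qh_least_exponent:
  assumes "x \<noteq> 0"
  obtains a where "qcoeff x a \<noteq> 0" "\<And>b. b < a \<Longrightarrow> qcoeff x b = 0"
proof -
  obtain a where "qcoeff x a \<noteq> 0" using assms qh_eqI[of x 0] by (auto simp: zero_qh.rep_eq)
  then show ?thesis using that by (rule left_finite_least_exponent[OF left_finite_qcoeff])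
qed

text \<open>The valuation ring of the Novikov field, the valuation being the exponent of the lowest
  term.\<close>

definition integral_novikov :: "'b::field novikov \<Rightarrow> bool" where
  "integral_novikov k \<longleftrightarrow> (\<forall>a<0. ncoeff k a = 0)"

text \<open>Otherwise the lowest term of the inverse, at a negative exponent, would survive
  multiplication by the constant term of \<open>k\<close>, although the product is 1.\<close>

lemma integral_novikov_inverse:
  assumes "integral_novikov k" "ncoeff k 0 \<noteq> 0"
  shows "integral_novikov (inverse k)"
proof (rule ccontr)
  assume "\<not> integral_novikov (inverse k)"
  then obtain c where c: "c < 0" "ncoeff (inverse k) c \<noteq> 0" by (auto simp: integral_novikov_def)
  obtain a where a: "ncoeff (inverse k) a \<noteq> 0" "\<And>b. b < a \<Longrightarrow> ncoeff (inverse k) b = 0"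
    using left_finite_least_exponent[OF left_finite_ncoeff c(2)] by blast
  have "a < 0" using a(2)[of c] c by force
  have "k \<noteq> 0" using assms(2) by (auto simp: zero_novikov.rep_eq)
  have "ncoeff (k * inverse k) (0 + a) = ncoeff k 0 * ncoeff (inverse k) a"
    unfolding times_novikov.rep_eq
    by (rule mult_module.conv_lowest(2)) (use assms(1) a(2) in \<open>auto simp: integral_novikov_def\<close>)
  then show False using \<open>k \<noteq> 0\<close> \<open>a < 0\<close> assms(2) a(1) by (simp add: one_novikov.rep_eq)
qed

text \<open>Clears denominators in a finite family: the least exponent that occurs in any member is
  moved to 0. A nontrivial relation thereby becomes one that reduces to a nontrivial
  relation.\<close>

lemma integral_novikov_normalise:
  assumes "finite I" "i \<in> I" "k i \<noteq> 0"
  obtains c where "\<And>i. i \<in> I \<Longrightarrow> integral_novikov (nmonom c 1 * k i)"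
    and "\<exists>i\<in>I. ncoeff (nmonom c 1 * k i) 0 \<noteq> 0"
proof -
  \<comment> \<open>The support of \<open>s\<close> is the union of the supports of the
    \<open>k i\<close>, so its least exponent is the least one of the family.\<close>
  define s where "s a = (if \<exists>i\<in>I. ncoeff (k i) a \<noteq> 0 then 1 else 0 :: real)" for a
  have "{a. s a \<noteq> 0 \<and> a \<le> c} = (\<Union>i\<in>I. {a. ncoeff (k i) a \<noteq> 0 \<and> a \<le> c})" for c
    by (auto simp: s_def)
  then have s: "left_finite s"
    using assms(1) by (simp add: left_finite_def left_finite_ncoeff[unfolded left_finite_def])
  obtain a where "ncoeff (k i) a \<noteq> 0" using assms(3) ncoeff_eqI[of "k i" 0] by (auto simp: zero_novikov.rep_eq)
  then have "s a \<noteq> 0" using assms(2) by (auto simp: s_def)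
  then obtain a0 where a0: "s a0 \<noteq> 0" "\<And>b. b < a0 \<Longrightarrow> s b = 0"
    using left_finite_least_exponent[OF s] by blast
  have shift: "ncoeff (nmonom (- a0) 1 * k i) a = ncoeff (k i) (a + a0)" for i a
    by (simp add: times_novikov.rep_eq nmonom.rep_eq mult_module.conv_single_left)
  show ?thesis
  proof (rule that[of "- a0"])
    fix i assume "i \<in> I"
    then have "ncoeff (k i) b = 0" if "b < a0" for b
      using a0(2)[OF that] by (auto simp: s_def split: if_splits)
    then show "integral_novikov (nmonom (- a0) 1 * k i)" by (simp add: integral_novikov_def shift)
  next
    show "\<exists>i\<in>I. ncoeff (nmonom (- a0) 1 * k i) 0 \<noteq> 0"
      using a0(1) by (auto simp: shift s_def split: if_splits)
  qed
qed

section \<open>Initial parts\<close>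

text \<open>Reduction modulo the maximal ideal of the valuation ring. In contrast to \<open>ini\<close> it is
  additive, and on subspaces it has the same image.\<close>

definition reduces_to :: "('y::topological_space, 'b::field) qh \<Rightarrow> ('y, 'b) coh \<Rightarrow> bool" where
  "reduces_to x h \<longleftrightarrow> qcoeff x 0 = h \<and> (\<forall>a<0. qcoeff x a = 0)"

lemma reduces_to_unique: "reduces_to x h \<Longrightarrow> reduces_to x h' \<Longrightarrow> h = h'"
  by (simp add: reduces_to_def)

lemma reduces_to_0: "reduces_to 0 0"
  by (simp add: reduces_to_def zero_qh.rep_eq)

lemma reduces_to_const: "reduces_to (const_qh h) h"
  by (simp add: reduces_to_def qcoeff_const_qh)

lemma reduces_to_add: "reduces_to x h \<Longrightarrow> reduces_to y h' \<Longrightarrow> reduces_to (x + y) (h + h')"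
  by (simp add: reduces_to_def plus_qh.rep_eq)

lemma reduces_to_scale:
  assumes "integral_novikov k" "reduces_to x h"
  shows "reduces_to (qh_scale k x) (coh_scale (ncoeff k 0) h)"
  using coh.conv_lowest[of 0 "ncoeff k" 0 "qcoeff x"] assms
  by (simp add: reduces_to_def integral_novikov_def qh_scale.rep_eq)

lemma reduces_to_sum:
  "(\<And>i. i \<in> F \<Longrightarrow> reduces_to (f i) (g i)) \<Longrightarrow> reduces_to (sum f F) (sum g F)"
  by (simp add: reduces_to_def qcoeff_sum)

lemma ini_eqI:
  assumes "qcoeff x a \<noteq> 0" "\<And>b. b < a \<Longrightarrow> qcoeff x b = 0"
  shows "ini x = qcoeff x a"
proof -
  have "(LEAST a. qcoeff x a \<noteq> 0) = a"
    by (rule Least_equality) (use assms in \<open>auto simp: not_less[symmetric]\<close>)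
  then show ?thesis using assms(1) by (auto simp: ini_def zero_qh.rep_eq)
qed

text \<open>A nonzero element is multiplied by the power of \<open>T\<close> that moves its lowest
  term to exponent 0. Conversely, a nonzero reduction is the lowest coefficient.\<close>

lemma ini_image_iff:
  assumes S: "qh.subspace S"
  shows "h \<in> ini ` S \<longleftrightarrow> (\<exists>x\<in>S. reduces_to x h)"
proof
  assume "h \<in> ini ` S"
  then obtain x where x: "x \<in> S" "h = ini x" by blast
  show "\<exists>x\<in>S. reduces_to x h"
  proof (cases "x = 0")
    case True
    then show ?thesis using x reduces_to_0 by (auto simp: ini_def)
  next
    case False
    then obtain a where a: "qcoeff x a \<noteq> 0" "\<And>b. b < a \<Longrightarrow> qcoeff x b = 0"
      using nonzero_qh_least_exponent by blast
    have "reduces_to (qh_scale (nmonom (- a) 1) x) h"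
      using ini_eqI[OF a] a(2) x(2) by (simp add: reduces_to_def qcoeff_monom_scale)
    then show ?thesis using qh.subspace_scale[OF S x(1)] by blast
  qed
next
  assume "\<exists>x\<in>S. reduces_to x h"
  then obtain x where x: "x \<in> S" "reduces_to x h" by blast
  show "h \<in> ini ` S"
  proof (cases "h = 0")
    case True
    \<comment> \<open>An element that reduces to 0 may still have a nonzero initial part, so 0
      itself is the witness.\<close>
    have "ini 0 \<in> ini ` S" using qh.subspace_0[OF S] by (rule imageI)
    then show ?thesis using True by (simp add: ini_def)
  next
    case False
    then have "ini x = h" using x(2) ini_eqI[of x 0] by (simp add: reduces_to_def)
    then show ?thesis using x(1) by blast
  qed
qed

text \<open>Lowest terms may sit at different exponents, so sums are formed only after passing to
  elements that reduce to the given classes.\<close>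

lemma subspace_ini:
  assumes S: "qh.subspace S"
  shows "coh.subspace (ini ` S)"
proof (rule coh.subspaceI)
  show "0 \<in> ini ` S"
    unfolding ini_image_iff[OF S] using reduces_to_0 qh.subspace_0[OF S] by blast
  show "h + h' \<in> ini ` S" if "h \<in> ini ` S" "h' \<in> ini ` S" for h h'
    using that unfolding ini_image_iff[OF S] using reduces_to_add qh.subspace_add[OF S] by blast
  show "coh_scale r h \<in> ini ` S" if h: "h \<in> ini ` S" for r h
  proof -
    obtain x where x: "x \<in> S" "reduces_to x h" using h unfolding ini_image_iff[OF S] by blast
    have "reduces_to (qh_scale (nmonom 0 r) x) (coh_scale r h)"
      using x(2) by (simp add: reduces_to_def qcoeff_monom_scale)
    then show ?thesis unfolding ini_image_iff[OF S] using qh.subspace_scale[OF S x(1)] by blast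
  qed
qed

section \<open>Coordinates\<close>

definition coh_basis :: "('y::topological_space, 'b::field) coh set" where
  "coh_basis = coh.extend_basis {}"

lemma coh_basis_independent: "coh.independent coh_basis"
  and coh_basis_span: "h \<in> coh.span coh_basis"
  unfolding coh_basis_def
  using coh.independent_extend_basis[OF coh.independent_empty] coh.span_extend_basis[OF coh.independent_empty]
  by auto

text \<open>Total in \<open>b\<close>: outside the chosen basis the coordinate is 0, so it is linear
  in \<open>h\<close> for every \<open>b\<close>.\<close>

definition coh_coord :: "('y::topological_space, 'b::field) coh \<Rightarrow> ('y, 'b) coh \<Rightarrow> 'b" where
  "coh_coord b h = coh.representation coh_basis h b"

lemma coh_coord_add: "coh_coord b (h + h') = coh_coord b h + coh_coord b h'"
  by (simp add: coh_coord_def coh.representation_add[OF coh_basis_independent coh_basis_span coh_basis_span])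

lemma coh_coord_scale: "coh_coord b (coh_scale r h) = r * coh_coord b h"
  by (simp add: coh_coord_def coh.representation_scale[OF coh_basis_independent coh_basis_span])

lemma coh_coord_0: "coh_coord b 0 = 0"
  by (simp add: coh_coord_def coh.representation_zero)

lemma coh_coord_sum: "coh_coord b (sum f F) = (\<Sum>i\<in>F. coh_coord b (f i))"
  by (induction F rule: infinite_finite_induct) (simp_all add: coh_coord_0 coh_coord_add)

lemma finite_coh_coord: "finite {b. coh_coord b h \<noteq> 0}"
  by (simp add: coh_coord_def coh.finite_representation)

lemma coh_eq_sum_coord:
  assumes "finite F" "{b. coh_coord b h \<noteq> 0} \<subseteq> F"
  shows "(\<Sum>b\<in>F. coh_scale (coh_coord b h) b) = h"
proof -
  have "(\<Sum>b\<in>F. coh_scale (coh_coord b h) b) = (\<Sum>b | coh_coord b h \<noteq> 0. coh_scale (coh_coord b h) b)"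
    by (rule sum.mono_neutral_right) (use assms in auto)
  also have "\<dots> = h" unfolding coh_coord_def
    by (rule coh.sum_nonzero_representation_eq[OF coh_basis_independent coh_basis_span])
  finally show ?thesis .
qed

lemma coh_coord_nonzero:
  assumes "h \<noteq> 0" obtains b where "coh_coord b h \<noteq> 0"
  using assms coh_eq_sum_coord[of "{}" h] by auto

definition qh_coord :: "('y::topological_space, 'b::field) coh \<Rightarrow> ('y, 'b) qh \<Rightarrow> 'b novikov" where
  "qh_coord b x = Novikov (\<lambda>a. coh_coord b (qcoeff x a))"

lemma ncoeff_qh_coord: "ncoeff (qh_coord b x) a = coh_coord b (qcoeff x a)"
proof -
  have "finite {a. coh_coord b (qcoeff x a) \<noteq> 0 \<and> a \<le> c}" for c
  proof (rule finite_subset)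
    show "{a. coh_coord b (qcoeff x a) \<noteq> 0 \<and> a \<le> c} \<subseteq> {a. qcoeff x a \<noteq> 0 \<and> a \<le> c}"
      by (auto simp: coh_coord_0)
    show "finite {a. qcoeff x a \<noteq> 0 \<and> a \<le> c}"
      using left_finite_qcoeff[of x] by (simp add: left_finite_def)
  qed
  then show ?thesis by (simp add: qh_coord_def Novikov_inverse left_finite_def)
qed

lemma qh_coord_minus: "qh_coord b (x - y) = qh_coord b x - qh_coord b y"
proof (rule ncoeff_eqI)
  fix a
  have "coh_coord b (qcoeff (x - y) a) + coh_coord b (qcoeff y a) = coh_coord b (qcoeff x a)"
    by (simp add: qcoeff_minus flip: coh_coord_add)
  then show "ncoeff (qh_coord b (x - y)) a = ncoeff (qh_coord b x - qh_coord b y) a"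
    by (simp add: ncoeff_qh_coord minus_novikov.rep_eq eq_diff_eq)
qed

lemma qh_coord_scale: "qh_coord b (qh_scale k x) = k * qh_coord b x"
proof (rule ncoeff_eqI)
  fix a
  let ?T = "{c. ncoeff k c \<noteq> 0 \<and> qcoeff x (a - c) \<noteq> 0}"
  have T: "finite ?T"
    by (rule coh.conv_support_finite[OF left_finite_ncoeff left_finite_qcoeff])
  have "ncoeff (k * qh_coord b x) a = (\<Sum>c\<in>?T. ncoeff k c * ncoeff (qh_coord b x) (a - c))"
    unfolding times_novikov.rep_eq
    by (rule mult_module.conv_eq[OF T]) (auto simp: ncoeff_qh_coord coh_coord_0)
  then show "ncoeff (qh_coord b (qh_scale k x)) a = ncoeff (k * qh_coord b x) a"
    by (simp add: ncoeff_qh_coord qh_scale.rep_eq conv_def coh_coord_sum coh_coord_scale)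
qed

lemma qh_coord_sum: "qh_coord b (sum f F) = (\<Sum>i\<in>F. qh_coord b (f i))"
  by (rule ncoeff_eqI) (simp add: ncoeff_qh_coord ncoeff_sum qcoeff_sum coh_coord_sum)

lemma qcoeff_scale_const: "qcoeff (qh_scale k (const_qh h)) a = coh_scale (ncoeff k a) h"
proof -
  have "conv coh_scale (ncoeff k) (qcoeff (const_qh h)) a
      = (\<Sum>b\<in>{a}. coh_scale (ncoeff k b) (qcoeff (const_qh h) (a - b)))"
    by (rule coh.conv_eq) (auto simp: qcoeff_const_qh split: if_splits)
  then show ?thesis by (simp add: qh_scale.rep_eq qcoeff_const_qh)
qed

text \<open>This is where the finite rank of the elements of the algebraic tensor product enters.\<close>

lemma qh_eq_sum_coord:
  obtains F where "finite F" "x = (\<Sum>b\<in>F. qh_scale (qh_coord b x) (const_qh b))"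
    and "\<And>a. {b. coh_coord b (qcoeff x a) \<noteq> 0} \<subseteq> F"
proof -
  obtain B where B: "finite B" "range (qcoeff x) \<subseteq> coh.span B" using qcoeff[of x] by blast
  \<comment> \<open>A class in the span of \<open>B\<close> has nonzero coordinates only in
    \<open>F\<close>, so one finite set serves all exponents.\<close>
  define F where "F = (\<Union>h\<in>B. {b. coh_coord b h \<noteq> 0})"
  have F: "finite F" using B(1) by (simp add: F_def finite_coh_coord)
  have "coh_coord b h = 0" if "h \<in> coh.span B" "b \<notin> F" for b h
    using that(1)
  proof (induction rule: coh.span_induct_alt)
    case (step r h h')
    then show ?case using that(2) by (auto simp: F_def coh_coord_add coh_coord_scale)
  qed (simp add: coh_coord_0)
  then have sub: "{b. coh_coord b (qcoeff x a) \<noteq> 0} \<subseteq> F" for a using B(2) by blast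
  have "x = (\<Sum>b\<in>F. qh_scale (qh_coord b x) (const_qh b))"
    by (rule qh_eqI)
      (simp add: qcoeff_sum qcoeff_scale_const ncoeff_qh_coord coh_eq_sum_coord[OF F sub])
  then show ?thesis using that F sub by blast
qed

lemma integral_qh_coord:
  "(\<And>a. a < 0 \<Longrightarrow> qcoeff x a = 0) \<Longrightarrow> integral_novikov (qh_coord b x)"
  by (simp add: integral_novikov_def ncoeff_qh_coord coh_coord_0)

text \<open>Expand \<open>x\<close> in basis classes with integral coefficients and reduce termwise.
  Applied to multiplication by a constant element on either side, this carries the deformation
  property of the quantum product from constant elements to all elements without negative
  exponents.\<close>

lemma linear_reduces_to:
  assumes lin: "Vector_Spaces.linear qh_scale qh_scale f"
    and f: "\<And>b. reduces_to (f (const_qh b)) (g b)"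
    and x: "reduces_to x h"
  shows "reduces_to (f x) (g h)"
proof -
  interpret f: Vector_Spaces.linear qh_scale qh_scale f by (fact lin)
  obtain F where F: "finite F" "x = (\<Sum>b\<in>F. qh_scale (qh_coord b x) (const_qh b))"
    "\<And>a. {b. coh_coord b (qcoeff x a) \<noteq> 0} \<subseteq> F"
    using qh_eq_sum_coord[of x] by blast
  have comb: "reduces_to (f (\<Sum>b\<in>F. qh_scale (k b) (const_qh b))) (\<Sum>b\<in>F. coh_scale (ncoeff (k b) 0) (g b))"
    if "\<And>b. integral_novikov (k b)" for k
    unfolding f.sum f.scale by (rule reduces_to_sum, rule reduces_to_scale[OF that f])
  \<comment> \<open>The coordinates of \<open>h\<close> as constant series. They rebuild
    \<open>const_qh h\<close>, whose image reduces to \<open>g h\<close>, and they have the same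
    constant terms as the coordinates of \<open>x\<close>. Uniqueness of reductions thus supplies
    the linearity of \<open>g\<close> that is used.\<close>
  define k where "k b = nmonom 0 (coh_coord b h)" for b
  have k: "integral_novikov (k b)" for b
    by (simp add: k_def integral_novikov_def nmonom.rep_eq)
  have "{b. coh_coord b h \<noteq> 0} \<subseteq> F" using F(3)[of 0] x by (simp add: reduces_to_def)
  then have "(\<Sum>b\<in>F. qh_scale (k b) (const_qh b)) = const_qh h"
    by (intro qh_eqI)
      (simp add: qcoeff_sum k_def nmonom.rep_eq qcoeff_scale_const qcoeff_const_qh coh_eq_sum_coord[OF F(1)])
  then have "g h = (\<Sum>b\<in>F. coh_scale (ncoeff (k b) 0) (g b))"
    using reduces_to_unique[OF f] comb[of k, OF k] by simp
  also have "\<dots> = (\<Sum>b\<in>F. coh_scale (ncoeff (qh_coord b x) 0) (g b))"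
    using x by (simp add: k_def nmonom.rep_eq ncoeff_qh_coord reduces_to_def)
  finally show ?thesis
    using comb[of "\<lambda>b. qh_coord b x"] F(2) x by (simp add: integral_qh_coord reduces_to_def)
qed

section \<open>The rank of the initial part\<close>

text \<open>A nontrivial relation is scaled by a power of \<open>T\<close> until its coefficients
  are integral with some nonzero constant term; it then reduces to a nontrivial relation in
  \<open>B\<close>.\<close>

lemma independent_lift:
  assumes B: "finite B" "coh.independent B" and x: "\<And>h. h \<in> B \<Longrightarrow> reduces_to (x h) h"
  shows "inj_on x B" "qh.independent (x ` B)"
proof -
  have zero: "c h = 0" if sum: "(\<Sum>h\<in>B. qh_scale (c h) (x h)) = 0" and h: "h \<in> B" for c h
  proof (rule ccontr)
    assume "c h \<noteq> 0"
    then obtain d where int: "\<And>h. h \<in> B \<Longrightarrow> integral_novikov (nmonom d 1 * c h)"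
      and nz: "\<exists>h\<in>B. ncoeff (nmonom d 1 * c h) 0 \<noteq> 0"
      using integral_novikov_normalise[OF B(1) h] by blast
    have "reduces_to (\<Sum>h\<in>B. qh_scale (nmonom d 1 * c h) (x h))
        (\<Sum>h\<in>B. coh_scale (ncoeff (nmonom d 1 * c h) 0) h)"
      by (rule reduces_to_sum, rule reduces_to_scale) (auto simp: int x)
    moreover have "(\<Sum>h\<in>B. qh_scale (nmonom d 1 * c h) (x h)) = qh_scale (nmonom d 1) (\<Sum>h\<in>B. qh_scale (c h) (x h))"
      by (simp add: qh.scale_sum_right)
    ultimately have "(\<Sum>h\<in>B. coh_scale (ncoeff (nmonom d 1 * c h) 0) h) = 0"
      using sum by (auto intro: reduces_to_unique reduces_to_0)
    then show False using coh.independentD[OF B(2,1) subset_refl, of "\<lambda>h. ncoeff (nmonom d 1 * c h) 0"] nz by blast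
  qed
  show "inj_on x B" "qh.independent (x ` B)" by (rule qh.independent_image[OF B(1)], erule zero, assumption)+
qed

text \<open>A reduced row echelon form over the valuation ring, with rows \<open>x p\<close> indexed
  by their pivots. Pivots lie in \<open>coh_basis\<close> automatically, as all other coordinates
  vanish.\<close>

definition echelon :: "('y::topological_space, 'b::field) qh set \<Rightarrow> ('y, 'b) coh set \<Rightarrow>
    (('y, 'b) coh \<Rightarrow> ('y, 'b) qh) \<Rightarrow> bool" where
  "echelon S P x \<longleftrightarrow> finite P \<and> (\<forall>p\<in>P. x p \<in> S \<and> (\<forall>a<0. qcoeff (x p) a = 0) \<and>
     (\<forall>q\<in>P. qh_coord q (x p) = (if q = p then 1 else 0)))"

text \<open>Gaussian elimination over the valuation ring: the pivot is a coordinate of least valuation.\<close>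

lemma echelon_step:
  assumes S: "qh.subspace S" and e: "echelon S P x" and y: "y \<in> S" "y \<notin> qh.span (x ` P)"
  shows "\<exists>b x'. b \<notin> P \<and> echelon S (insert b P) x'"
proof -
  have P: "finite P" and xS: "\<And>p. p \<in> P \<Longrightarrow> x p \<in> S"
    and x0: "\<And>p a. p \<in> P \<Longrightarrow> a < 0 \<Longrightarrow> qcoeff (x p) a = 0"
    and xc: "\<And>p q. p \<in> P \<Longrightarrow> q \<in> P \<Longrightarrow> qh_coord q (x p) = (if q = p then 1 else 0)"
    using e by (auto simp: echelon_def)
  \<comment> \<open>The part of \<open>y\<close> that the present pivots account for. Subtracting it
    makes the old pivot coordinates vanish, and the difference is nonzero because \<open>y\<close>
    is outside the span.\<close>
  define w where "w = (\<Sum>p\<in>P. qh_scale (qh_coord p y) (x p))"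
  have "w \<in> qh.span (x ` P)" unfolding w_def
    by (intro qh.span_sum qh.span_scale qh.span_base imageI)
  then have yw: "y - w \<noteq> 0" using y(2) by auto
  have "w \<in> S" unfolding w_def by (intro qh.subspace_sum[OF S] qh.subspace_scale[OF S] xS)
  then have ywS: "y - w \<in> S" using qh.subspace_diff[OF S y(1)] by blast
  have ywP: "qh_coord q (y - w) = 0" if q: "q \<in> P" for q
  proof -
    have "qh_coord q w = (\<Sum>p\<in>P. if q = p then qh_coord p y else 0)"
      unfolding w_def qh_coord_sum qh_coord_scale by (rule sum.cong) (auto simp: xc q)
    also have "\<dots> = qh_coord q y" using P q by simp
    finally show ?thesis by (simp add: qh_coord_minus)
  qed
  obtain a where a: "qcoeff (y - w) a \<noteq> 0" "\<And>b. b < a \<Longrightarrow> qcoeff (y - w) b = 0"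
    using nonzero_qh_least_exponent[OF yw] by blast
  define u where "u = qh_scale (nmonom (- a) 1) (y - w)"
  have u: "qcoeff u c = qcoeff (y - w) (c + a)" for c by (simp add: u_def qcoeff_monom_scale)
  \<comment> \<open>After the shift some coordinate has a nonzero constant term. It is a unit of the
    valuation ring, so dividing by it creates no negative exponents.\<close>
  obtain b where b: "coh_coord b (qcoeff u 0) \<noteq> 0" using coh_coord_nonzero a(1) by (metis u add_0)
  define k where "k = inverse (qh_coord b u)"
  define z where "z = qh_scale k u"
  have uc: "integral_novikov (qh_coord c u)" for c using a(2) by (auto intro!: integral_qh_coord simp: u)
  have ub: "ncoeff (qh_coord b u) 0 \<noteq> 0" using b by (simp add: ncoeff_qh_coord)
  have k: "integral_novikov k" unfolding k_def by (rule integral_novikov_inverse[OF uc ub])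
  have "reduces_to u (qcoeff u 0)" using a(2) by (simp add: reduces_to_def u)
  then have z0: "qcoeff z c = 0" if "c < 0" for c
    using reduces_to_scale[OF k] that by (auto simp: z_def reduces_to_def)
  have "qh_coord b u \<noteq> 0" using ub by (auto simp: zero_novikov.rep_eq)
  then have zb: "qh_coord b z = 1" by (simp add: z_def k_def qh_coord_scale)
  have zP: "qh_coord q z = 0" if "q \<in> P" for q by (simp add: z_def u_def qh_coord_scale ywP that)
  have zS: "z \<in> S" unfolding z_def u_def by (intro qh.subspace_scale[OF S] ywS)
  have bP: "b \<notin> P" using zb zP by auto
  \<comment> \<open>The new coordinate is cleared from the old rows. Its entries there are integral,
    so the rows stay integral; the old pivots survive because \<open>z\<close> vanishes in
    them.\<close>
  define x' where "x' p = (if p = b then z else x p - qh_scale (qh_coord b (x p)) z)" for p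
  have "echelon S (insert b P) x'" unfolding echelon_def
  proof (intro conjI ballI allI impI)
    show "finite (insert b P)" using P by simp
    show "x' p \<in> S" if "p \<in> insert b P" for p
      using that by (auto simp: x'_def intro!: zS xS qh.subspace_diff[OF S] qh.subspace_scale[OF S])
    show "qcoeff (x' p) c = 0" if p: "p \<in> insert b P" and c: "c < 0" for p c
    proof (cases "p = b")
      case False
      then have "p \<in> P" using p by simp
      have "integral_novikov (qh_coord b (x p))" by (rule integral_qh_coord) (rule x0[OF \<open>p \<in> P\<close>])
      moreover have "reduces_to z (qcoeff z 0)" by (simp add: reduces_to_def z0)
      ultimately have "qcoeff (qh_scale (qh_coord b (x p)) z) c = 0"
        using reduces_to_scale c unfolding reduces_to_def by blast
      then show ?thesis using False x0[OF \<open>p \<in> P\<close> c] by (simp add: x'_def qcoeff_minus)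
    qed (simp add: x'_def z0 c)
    show "qh_coord q (x' p) = (if q = p then 1 else 0)" if "p \<in> insert b P" "q \<in> insert b P" for p q
      using that bP by (auto simp: x'_def zb zP xc qh_coord_minus qh_coord_scale)
  qed
  then show ?thesis using bP by blast
qed

text \<open>An independent set with more elements than there are rows cannot lie in the span of the
  rows, so a further pivot can be found.\<close>

lemma echelon_exists:
  assumes S: "qh.subspace S" and Y: "Y \<subseteq> S" "finite Y" "qh.independent Y" and "k \<le> card Y"
  shows "\<exists>P x. card P = k \<and> echelon S P x"
  using \<open>k \<le> card Y\<close>
proof (induction k)
  case 0
  have "card {} = 0 \<and> echelon S {} x" for x by (simp add: echelon_def)
  then show ?case by blast
next
  case (Suc k)
  then obtain P x where P: "card P = k" "echelon S P x" by auto
  have fin: "finite P" using P(2) by (simp add: echelon_def)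
  have "\<not> Y \<subseteq> qh.span (x ` P)"
    using qh.independent_span_bound[of "x ` P" Y] fin Y(3) card_image_le[OF fin, of x] P(1) Suc.prems
    by auto
  then obtain y where "y \<in> S" "y \<notin> qh.span (x ` P)" using Y(1) by blast
  then obtain b x' where "b \<notin> P" "echelon S (insert b P) x'" using echelon_step[OF S P(2)] by blast
  then show ?case using P(1) fin by (intro exI[of _ "insert b P"] exI[of _ x']) simp
qed

lemma enat_eqI:
  assumes "\<And>n. enat n \<le> a \<longleftrightarrow> enat n \<le> b" shows "a = b"
proof (cases a; cases b)
  fix i j assume "a = enat i" "b = enat j"
  then show ?thesis using assms[of i] assms[of j] by simp
next
  fix i assume "a = enat i" "b = \<infinity>"
  then show ?thesis using assms[of "Suc i"] by simp
next
  fix j assume "a = \<infinity>" "b = enat j"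
  then show ?thesis using assms[of "Suc j"] by simp
qed simp

text \<open>Each implication transports an independent set of size \<open>n\<close>: by lifting to
  \<open>S\<close> in one direction, by the constant terms of an echelon form in the other.\<close>

lemma rank_ini:
  assumes S: "qh.subspace S"
  shows "coh.rank (ini ` S) = qh.rank S"
proof -
  have "enat n \<le> coh.rank (ini ` S) \<longleftrightarrow> enat n \<le> qh.rank S" for n
    unfolding coh.enat_le_rank_iff qh.enat_le_rank_iff
  proof
    assume "\<exists>B\<subseteq>ini ` S. finite B \<and> coh.independent B \<and> card B = n"
    then obtain B where B: "B \<subseteq> ini ` S" "finite B" "coh.independent B" "card B = n" by blast
    have "\<forall>h\<in>B. \<exists>x\<in>S. reduces_to x h" using B(1) ini_image_iff[OF S] by blast
    then obtain x where x: "\<And>h. h \<in> B \<Longrightarrow> x h \<in> S \<and> reduces_to (x h) h" by metis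
    have "inj_on x B" "qh.independent (x ` B)" by (rule independent_lift[OF B(2,3)]; simp add: x)+
    then have "x ` B \<subseteq> S \<and> finite (x ` B) \<and> qh.independent (x ` B) \<and> card (x ` B) = n"
      using B x by (auto simp: card_image)
    then show "\<exists>B\<subseteq>S. finite B \<and> qh.independent B \<and> card B = n" by blast
  next
    assume "\<exists>B\<subseteq>S. finite B \<and> qh.independent B \<and> card B = n"
    then obtain P x where P: "card P = n" "echelon S P x" using echelon_exists[OF S] by blast
    have fin: "finite P" using P(2) by (simp add: echelon_def)
    let ?v = "\<lambda>p. qcoeff (x p) 0"
    \<comment> \<open>The matrix of pivot coordinates is the identity and remains so after
      reduction, which makes the classes \<open>?v p\<close> independent.\<close>
    have v: "coh_coord q (?v p) = (if q = p then 1 else 0)" if "p \<in> P" "q \<in> P" for p q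
      using P(2) that by (auto simp: echelon_def one_novikov.rep_eq zero_novikov.rep_eq simp flip: ncoeff_qh_coord)
    have zero: "c q = 0" if sum: "(\<Sum>p\<in>P. coh_scale (c p) (?v p)) = 0" and q: "q \<in> P" for c q
    proof -
      have "0 = coh_coord q (\<Sum>p\<in>P. coh_scale (c p) (?v p))" unfolding sum by (rule coh_coord_0[symmetric])
      also have "\<dots> = (\<Sum>p\<in>P. if q = p then c p else 0)"
        unfolding coh_coord_sum coh_coord_scale by (rule sum.cong) (auto simp: v q)
      also have "\<dots> = c q" using fin q by simp
      finally show ?thesis by simp
    qed
    have "inj_on ?v P" "coh.independent (?v ` P)"
      by (rule coh.independent_image[OF fin], erule zero, assumption)+
    moreover have "?v ` P \<subseteq> ini ` S"
    proof (rule image_subsetI)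
      fix p assume p: "p \<in> P"
      then have "x p \<in> S" "reduces_to (x p) (?v p)" using P(2) by (auto simp: echelon_def reduces_to_def)
      then show "?v p \<in> ini ` S" unfolding ini_image_iff[OF S] by blast
    qed
    ultimately have "?v ` P \<subseteq> ini ` S \<and> finite (?v ` P) \<and> coh.independent (?v ` P) \<and> card (?v ` P) = n"
      using fin P(1) by (auto simp: card_image)
    then show "\<exists>B\<subseteq>ini ` S. finite B \<and> coh.independent B \<and> card B = n" by blast
  qed
  then show ?thesis by (rule enat_eqI)
qed

section \<open>Parity decomposition\<close>

definition cochain_part :: "nat \<Rightarrow> ('y::topological_space, 'b::field) cochain \<Rightarrow> ('y, 'b) cochain" where
  "cochain_part i c p s = (if p mod 2 = i mod 2 then c p s else 0)"

lemma is_cochain_part: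
  assumes "is_cochain c" shows "is_cochain (cochain_part i c)"
proof -
  have "{p. cochain_part i c p \<noteq> (\<lambda>_. 0)} \<subseteq> {p. c p \<noteq> (\<lambda>_. 0)}"
    by (auto simp: cochain_part_def fun_eq_iff)
  then have "finite {p. cochain_part i c p \<noteq> (\<lambda>_. 0)}"
    using assms by (auto simp: is_cochain_def intro: finite_subset)
  moreover have "cochain_part i c p s = 0" if "\<not> singular_simplex p euclidean s" for p s
    using assms that by (simp add: is_cochain_def cochain_part_def)
  ultimately show ?thesis unfolding is_cochain_def by blast
qed

text \<open>The coboundary raises the degree by one and so swaps the parities. Degree 0 is separate
  because coboundaries vanish there.\<close>

lemma coboundary_part: "coboundary (cochain_part (Suc i) c) = cochain_part i (coboundary c)"
proof (intro ext)
  fix p s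
  show "coboundary (cochain_part (Suc i) c) p s = cochain_part i (coboundary c) p s"
  proof (cases p)
    case (Suc q)
    then have "q mod 2 = Suc i mod 2 \<longleftrightarrow> p mod 2 = i mod 2" by (auto simp: mod2_eq_if)
    then show ?thesis using Suc by (simp add: coboundary_def cochain_part_def)
  qed (simp add: coboundary_def cochain_part_def)
qed

lemma cochain_part_Suc_Suc: "cochain_part (Suc (Suc i)) c = cochain_part i c"
  by (intro ext) (simp add: cochain_part_def)

lemma is_cocycle_part:
  assumes "is_cocycle c" shows "is_cocycle (cochain_part i c)"
proof -
  have "coboundary (cochain_part i c) = cochain_part (Suc i) (coboundary c)"
    using coboundary_part[of "Suc i" c] by (simp add: cochain_part_Suc_Suc)
  then show ?thesis using assms by (simp add: is_cocycle_def is_cochain_part cochain_part_def fun_eq_iff)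
qed

text \<open>If \<open>c\<close> bounds the difference of two cocycles, then its part of the opposite
  parity bounds the difference of their parts.\<close>

lift_definition coh_part :: "nat \<Rightarrow> ('y::topological_space, 'b::field) coh \<Rightarrow> ('y, 'b) coh" is cochain_part
proof -
  fix i and a b :: "('y, 'b) cochain"
  assume "cohomologous a b"
  then obtain c where c: "is_cocycle a" "is_cocycle b" "is_cochain c" "\<forall>p s. a p s - b p s = coboundary c p s"
    by (rule cohomologousE)
  show "cohomologous (cochain_part i a) (cochain_part i b)"
    by (rule cohomologousI[OF is_cocycle_part[OF c(1)] is_cocycle_part[OF c(2)] is_cochain_part[OF c(3), of "Suc i"]])
      (use c(4) in \<open>auto simp: coboundary_part, simp_all add: cochain_part_def\<close>)
qed

lemma coh_part_add: "coh_part i (h + h') = coh_part i h + coh_part i h'"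
proof transfer
  fix i and a b :: "('a, 'b) cochain"
  assume a: "cohomologous a a" and b: "cohomologous b b"
  have "is_cocycle (\<lambda>p s. cochain_part i a p s + cochain_part i b p s)"
    using a b by (intro is_cocycle_add is_cocycle_part) (auto simp: cohomologous_def)
  then show "cohomologous (cochain_part i (\<lambda>p s. a p s + b p s)) (\<lambda>p s. cochain_part i a p s + cochain_part i b p s)"
    by (rule cohomologous_eqI[OF cohomologous_refl]) (simp add: cochain_part_def distrib_left)
qed

lemma coh_part_scale: "coh_part i (coh_scale r h) = coh_scale r (coh_part i h)"
proof transfer
  fix i r and a :: "('a, 'b) cochain"
  assume a: "cohomologous a a"
  have "is_cocycle (\<lambda>p s. r * cochain_part i a p s)"
    using a by (intro is_cocycle_scale is_cocycle_part) (auto simp: cohomologous_def)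
  then show "cohomologous (cochain_part i (\<lambda>p s. r * a p s)) (\<lambda>p s. r * cochain_part i a p s)"
    by (rule cohomologous_eqI[OF cohomologous_refl]) (simp add: cochain_part_def distrib_left)
qed

lemma coh_part_0: "coh_part i 0 = 0"
  using coh_part_add[of i 0 0] by simp

lemma coh_part_sum: "coh_part 0 h + coh_part 1 h = h"
proof transfer
  fix a :: "('a, 'b) cochain"
  assume "cohomologous a a"
  then show "cohomologous (\<lambda>p s. cochain_part 0 a p s + cochain_part 1 a p s) a"
    by (rule cohomologous_eqI) (auto simp: cochain_part_def)
qed

lemma coh_part_in_parity: "coh_part i h \<in> coh_parity i"
proof -
  have coc: "is_cocycle (rep_coh h)"
    using Quotient3_rel_rep[OF Quotient3_coh] Quotient3_rep_reflp[OF Quotient3_coh, of h]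
    by (auto simp: cohomologous_def)
  have "coh_part i h = abs_coh (cochain_part i (rep_coh h))"
    by (simp add: coh_part_def)
  then show ?thesis
    using is_cocycle_part[OF coc, of i] unfolding coh_parity_def by (auto simp: cochain_part_def fun_eq_iff)
qed

lift_definition qh_part :: "nat \<Rightarrow> ('y::topological_space, 'b::field) qh \<Rightarrow> ('y, 'b) qh"
  is "\<lambda>i x a. coh_part i (x a)"
proof (elim conjE exE, intro conjI)
  fix i B and x :: "real \<Rightarrow> ('y, 'b) coh"
  assume x: "left_finite x" and B: "finite B" "range x \<subseteq> coh.span B"
  show "left_finite (\<lambda>a. coh_part i (x a))" unfolding left_finite_def
  proof
    fix c
    have "{a. coh_part i (x a) \<noteq> 0 \<and> a \<le> c} \<subseteq> {a. x a \<noteq> 0 \<and> a \<le> c}" by (auto simp: coh_part_0)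
    then show "finite {a. coh_part i (x a) \<noteq> 0 \<and> a \<le> c}"
      using x finite_subset unfolding left_finite_def by blast
  qed
  have "coh_part i h \<in> coh.span (coh_part i ` B)" if "h \<in> coh.span B" for h
    using that
  proof (induction rule: coh.span_induct_alt)
    case (step r h h')
    then show ?case
      unfolding coh_part_add coh_part_scale
      by (intro coh.span_add[OF coh.span_scale[OF coh.span_base[OF imageI]]])
  qed (simp add: coh_part_0 coh.span_zero)
  then have "range (\<lambda>a. coh_part i (x a)) \<subseteq> coh.span (coh_part i ` B)" using B(2) by blast
  then show "\<exists>B. finite B \<and> range (\<lambda>a. coh_part i (x a)) \<subseteq> coh.span B" using B(1) by blast
qed

lemma qh_part_sum: "qh_part 0 x + qh_part 1 x = x"
  by (rule qh_eqI) (simp only: plus_qh.rep_eq qh_part.rep_eq coh_part_sum)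

lemma qh_part_in_parity: "qh_part i x \<in> qh_parity i"
  by (simp add: qh_parity_def qh_part.rep_eq coh_part_in_parity)

section \<open>The filtration\<close>

lemma small_slope_generic: "small_slope \<phi> \<delta> \<Longrightarrow> generic_slope \<phi> \<delta>"
  by (auto simp: small_slope_def generic_slope_def)

lemma small_slope_mono: "small_slope \<phi> \<delta> \<Longrightarrow> 0 < \<kappa> \<Longrightarrow> \<kappa> \<le> \<delta> \<Longrightarrow> small_slope \<phi> \<kappa>"
  by (force simp: small_slope_def)

context floer_theory
begin

context
  fixes \<delta> \<kappa> assumes \<delta>: "small_slope \<phi> \<delta>" and \<kappa>: "generic_slope \<phi> \<kappa>"
begin

abbreviation (input) c :: "('y, 'b) qh \<Rightarrow> 'v" where "c \<equiv> c_map PSS cont \<delta> \<kappa>"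

lemma small_slope_min: "small_slope \<phi> (min \<delta> \<kappa>)"
  using \<delta> \<kappa> by (auto intro!: small_slope_mono[OF \<delta>] simp: generic_slope_def small_slope_def)

lemmas generic_slope_min = small_slope_generic[OF small_slope_min]

lemma PSS_in_HF: "PSS (min \<delta> \<kappa>) x \<in> HF (min \<delta> \<kappa>)"
  using PSS_iso[OF small_slope_min] by (auto simp: bij_betw_def)

lemma c_map_add: "c (x + y) = c x + c y"
proof -
  interpret P: Vector_Spaces.linear qh_scale scale "PSS (min \<delta> \<kappa>)" by (rule PSS_linear[OF small_slope_min])
  show ?thesis by (simp add: c_map_def P.add cont_add[OF generic_slope_min \<kappa> _ PSS_in_HF PSS_in_HF])
qed

lemma c_map_scale: "c (qh_scale k x) = scale k (c x)"
proof -
  interpret P: Vector_Spaces.linear qh_scale scale "PSS (min \<delta> \<kappa>)" by (rule PSS_linear[OF small_slope_min])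
  show ?thesis by (simp add: c_map_def P.scale cont_scale[OF generic_slope_min \<kappa> _ PSS_in_HF])
qed

text \<open>PSS turns the quantum product into the cap action, which commutes with continuation;
  hence the kernel of \<open>c\<close> is a left ideal.\<close>

lemma c_map_mult: "c (x \<star> y) = act \<kappa> x (c y)"
  by (simp add: c_map_def PSS_mult[OF small_slope_min] cont_act[OF generic_slope_min \<kappa> _ PSS_in_HF])

lemma c_map_parity: "x \<in> qh_parity i \<Longrightarrow> c x \<in> HF_gr \<kappa> i"
  using PSS_degree[OF small_slope_min, of i] cont_degree[OF generic_slope_min \<kappa>, of i]
  by (fastforce simp: c_map_def)

lemma c_map_0: "c 0 = 0"
  using c_map_add[of 0 0] by simp

lemma act_0: "act \<kappa> x 0 = 0"
proof -
  interpret vector_space scale by (rule vector_space)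
  have "0 \<in> HF \<kappa>" by (rule subspace_0[OF HF_subspace[OF \<kappa>]])
  then show ?thesis using act_add[OF \<kappa>, of 0 0 x] by simp
qed

text \<open>The kernel of \<open>c\<close> is graded because \<open>HF \<kappa>\<close> is the direct sum of its parity parts.\<close>

lemma c_map_part_0:
  assumes "c x = 0" shows "c (qh_part 0 x) = 0" "c (qh_part 1 x) = 0"
proof -
  interpret vector_space scale by (rule vector_space)
  have sum: "c (qh_part 0 x) + c (qh_part 1 x) = 0"
    using assms by (simp only: c_map_add[symmetric] qh_part_sum)
  have mem: "c (qh_part i x) \<in> HF_gr \<kappa> i" for i by (rule c_map_parity[OF qh_part_in_parity])
  have "c (qh_part 0 x) = - c (qh_part 1 x)" using sum by (simp add: eq_neg_iff_add_eq_0)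
  then have "c (qh_part 0 x) \<in> HF_gr \<kappa> 1" using subspace_neg[OF HF_gr_subspace[OF \<kappa>] mem[of 1]] by simp
  then show "c (qh_part 0 x) = 0" using mem[of 0] HF_gr_direct[OF \<kappa>] by blast
  then show "c (qh_part 1 x) = 0" using sum by simp
qed

text \<open>Graded commutativity exchanges the factors only when both have pure parity. Hence both
  are split; the parts of \<open>x\<close> remain in the kernel, and the signs are harmless by
  linearity.\<close>

lemma c_map_mult_right_0:
  assumes x: "c x = 0" shows "c (x \<star> y) = 0"
proof -
  interpret vector_space scale by (rule vector_space)
  have distrib: "u \<star> (v + w) = u \<star> v + u \<star> w" "(u + v) \<star> w = u \<star> w + v \<star> w" for u v w
    using quantum by (simp_all add: quantum_product_def Vector_Spaces.linear_iff)
  have comm: "u \<star> v = qh_scale ((- 1) ^ (j * i)) (v \<star> u)" if "u \<in> qh_parity i" "v \<in> qh_parity j" for u v i j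
    using quantum that unfolding quantum_product_def by blast
  have parts: "c (qh_part i x \<star> qh_part j y) = 0" if "c (qh_part i x) = 0" for i j
    by (subst comm[OF qh_part_in_parity qh_part_in_parity]) (simp add: c_map_scale c_map_mult that act_0)
  have "x \<star> y = (qh_part 0 x + qh_part 1 x) \<star> (qh_part 0 y + qh_part 1 y)" by (simp only: qh_part_sum)
  also have "\<dots> = (qh_part 0 x \<star> qh_part 0 y + qh_part 1 x \<star> qh_part 0 y)
      + (qh_part 0 x \<star> qh_part 1 y + qh_part 1 x \<star> qh_part 1 y)"
    by (simp only: distrib)
  finally show ?thesis using parts c_map_part_0[OF x] by (simp add: c_map_add)
qed

end

lemma subspace_floer_filtration:
  assumes "small_slope \<phi> \<delta>" shows "qh.subspace (floer_filtration \<phi> PSS cont \<delta> p)"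
proof -
  interpret vector_space scale by (rule vector_space)
  show ?thesis
    using assms by (intro qh.subspaceI) (auto simp: floer_filtration_def c_map_0 c_map_add c_map_scale)
qed

lemma floer_filtration_ideal:
  assumes "small_slope \<phi> \<delta>" "x \<in> floer_filtration \<phi> PSS cont \<delta> p"
  shows "y \<star> x \<in> floer_filtration \<phi> PSS cont \<delta> p" "x \<star> y \<in> floer_filtration \<phi> PSS cont \<delta> p"
proof -
  show "y \<star> x \<in> floer_filtration \<phi> PSS cont \<delta> p"
    using assms by (auto simp: floer_filtration_def c_map_mult act_0)
  show "x \<star> y \<in> floer_filtration \<phi> PSS cont \<delta> p"
    using assms by (auto simp: floer_filtration_def c_map_mult_right_0)
qed

text \<open>An initial part \<open>h\<close> lifts to an element \<open>x\<close> of the quantum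
  ideal reducing to it. The products of \<open>x\<close> with \<open>const_qh g\<close> stay in that
  ideal and reduce to the cup products with \<open>g\<close>.\<close>

lemma cup_ideal_specialised_filtration:
  assumes "small_slope \<phi> \<delta>" shows "cup_ideal (specialised_filtration \<phi> PSS cont \<delta> p)"
proof -
  let ?F = "floer_filtration \<phi> PSS cont \<delta> p"
  have F: "qh.subspace ?F" by (rule subspace_floer_filtration[OF assms])
  have const: "reduces_to (const_qh g \<star> const_qh h) (g \<smile> h)" for g h
    using quantum by (simp add: quantum_product_def reduces_to_def)
  have mult: "reduces_to (const_qh g \<star> x) (g \<smile> h)" "reduces_to (x \<star> const_qh g) (h \<smile> g)"
    if "reduces_to x h" for g h x
    by (rule linear_reduces_to[OF _ _ that]; use quantum const in \<open>simp add: quantum_product_def\<close>)+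
  have "g \<smile> h \<in> ini ` ?F \<and> h \<smile> g \<in> ini ` ?F" if "h \<in> ini ` ?F" for g h
    using that mult floer_filtration_ideal[OF assms] unfolding ini_image_iff[OF F] by blast
  then show ?thesis using subspace_ini[OF F] by (auto simp: cup_ideal_def specialised_filtration_def)
qed

end

text \<open>A larger level intersects fewer kernels.\<close>

lemma floer_filtration_mono:
  "p \<le> q \<Longrightarrow> floer_filtration \<phi> PSS cont \<delta> p \<subseteq> floer_filtration \<phi> PSS cont \<delta> q"
  by (auto simp: floer_filtration_def dest: order_trans[of p q])

theorem corollary1p30:
  fixes A :: "('y::{second_countable_topology, t2_space}, complex ^ 'n::finite) chart set"
    and \<Sigma> :: "('s::{second_countable_topology, t2_space}, 'f::euclidean_space) chart set"
    and qmult :: "('y, 'b::field) qh \<Rightarrow> ('y, 'b) qh \<Rightarrow> ('y, 'b) qh"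
    and scale :: "'b novikov \<Rightarrow> 'v::ab_group_add \<Rightarrow> 'v"
  assumes "over_convex_base A \<omega> I \<phi> H K \<Sigma> \<alpha> R0 I\<^sub>B \<Psi> f"
    and "weakly_monotone A \<omega> I"
    and "floer_theory \<phi> qmult scale HF HF_gr PSS cont act"
    and "small_slope \<phi> \<delta>"
  shows "(\<forall>p. p \<noteq> - \<infinity> \<longrightarrow> cup_ideal (specialised_filtration \<phi> PSS cont \<delta> p)) \<and>
    (\<forall>p q. p \<noteq> - \<infinity> \<longrightarrow> p \<le> q \<longrightarrow>
       specialised_filtration \<phi> PSS cont \<delta> p \<subseteq> specialised_filtration \<phi> PSS cont \<delta> q) \<and>
    specialised_filtration \<phi> PSS cont \<delta> \<infinity> = UNIV \<and>
    (\<forall>p. p \<noteq> - \<infinity> \<longrightarrow>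
       coh.rank (specialised_filtration \<phi> PSS cont \<delta> p) = qh.rank (floer_filtration \<phi> PSS cont \<delta> p))"
proof -
  interpret floer_theory \<phi> qmult scale HF HF_gr PSS cont act by (fact assms(3))
  have sub: "qh.subspace (floer_filtration \<phi> PSS cont \<delta> p)" for p
    by (rule subspace_floer_filtration[OF assms(4)])
  \<comment> \<open>At level \<open>\<infinity>\<close> the filtration is everything, so the lift
    \<open>const_qh h\<close> is available for every class.\<close>
  have "h \<in> specialised_filtration \<phi> PSS cont \<delta> \<infinity>" for h
    using reduces_to_const[of h] unfolding specialised_filtration_def ini_image_iff[OF sub]
    by (auto simp: floer_filtration_def)
  then have "specialised_filtration \<phi> PSS cont \<delta> \<infinity> = UNIV" by blast
  moreover have "specialised_filtration \<phi> PSS cont \<delta> p \<subseteq> specialised_filtration \<phi> PSS cont \<delta> q"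
    if "p \<le> q" for p q
    unfolding specialised_filtration_def by (rule image_mono, rule floer_filtration_mono[OF that])
  moreover have "coh.rank (specialised_filtration \<phi> PSS cont \<delta> p) = qh.rank (floer_filtration \<phi> PSS cont \<delta> p)" for p
    unfolding specialised_filtration_def by (rule rank_ini[OF sub])
  ultimately show ?thesis using cup_ideal_specialised_filtration[OF assms(4)] by simp
qed

end
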